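(* Assume that the bifurcation condition holds: for some $\varphi_0$ and real $\omega_0,\kappa_1$, $$\lambda_0(\varphi_0)=i\omega_0,\qquad \frac{\partial\lambda_0}{\partial\varphi}(\varphi_0)=i\kappa_1,$$ and that $\varphi_0$ is a regular point of the asymptotic continuous spectrum $\Lambda_0$. Additionally, let the points $\pm3i\omega_0$ not belong to the asymptotic continuous spectrum with $\varphi=\varphi_0$ (nonresonance condition), i.e. $\det\big[\pm3i\omega_0\,\mathrm{Id}-\sum_{m=-R}^{R}e^{im\varphi_0}M_m(0)\big]\neq0$. Let the nonlinearity $h$ be of third order. Introduce the small parameter $\varepsilon=1/N$ and apply the multiple scale ansatz $$y_j(t)=\varepsilon e^{i\omega_0t+i\varphi_0j}v_0A(T_1,x_1,T_2)+\varepsilon^3e^{3i(\omega_0t+\varphi_0j)}v_2A^3(T_1,x_1,T_2)+c.c.,$$ with the amplitude $A\in\mathbb{C}$ depending on the rescaled coordinates $T_1=\varepsilon t$, $T_2=\varepsilon^2t$ and $x_1=\varepsilon j$ ($c.c.$ denotes complex conjugated terms, $v_2\in\mathbb{C}^n$), to the system $$\dot y_j=\sum_{m=-R}^{R}\left(M_m(0)+\varepsilon^2rK_m+\mathcal{O}(\varepsilon^4)\right)y_{j+m}+h(y_{j-R},\dots,y_{j+R};p),$$ with the rescaled parameter $p=\varepsilon^2r$ and $j=1,\dots,N$ with periodic boundary conditions (indices modulo $N$). Then the solvability conditions up to the order $\varepsilon^3$ imply the following partial differential equation of Ginzburg–Landau type $$\partial_{T_2}u=r\kappa_2u+\frac{\kappa_3}{2}\partial_\xi^2u+\zeta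 u|u|^2$$ with periodic boundary conditions $u(\xi,T_2)=u(\xi+1,T_2)$, where $u(\xi,T_2)$ with $\xi\in[0,1]$ is related to the amplitude $A$ by $$A(T_1,x_1,T_2)=u(\kappa_1T_1+x_1,T_2).$$ The coefficient $\kappa_1$ is given by the bifurcation condition above or, equivalently, by $\kappa_1=\langle L_1v_0,v_1\rangle$, and $$\kappa_2=\langle L_Kv_0,v_1\rangle,\qquad\kappa_3=\langle L_2v_0,v_1\rangle.$$ Finally, the coefficient $\zeta$ of the nonlinearity and the vector $v_2\in\mathbb{C}^n$ are determined by $h$ according to $$\zeta=\langle h_1(v_0),v_1\rangle,\qquad v_2=\Big[3i\omega_0\,\mathrm{Id}-\sum_{m=-R}^{R}M_m(0)e^{3im\varphi_0}\Big]^{-1}h_2(v_0).$$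
   Context: Setting: a ring of $N$ identical coupled oscillators with states $y_j\in\mathbb{R}^n$, $\dot y_j=\sum_{m=-R}^{R}M_m(p)y_{j+m}+h(y_{j-R},\dots,y_{j+R};p)$, indices modulo $N$. The coupling range $R$ is fixed while $N\to\infty$. The $M_m(p)$ are $n\times n$ matrices depending on the bifurcation parameter $p$, with expansion $M_m(p)=M_m(0)+pK_m+\mathcal{O}(p^2)$. The nonlinear part satisfies $h(0,\dots,0;p)=0$ and has zero derivatives at the origin. All sums over $m$ extend over $-R\le m\le R$. Asymptotic continuous spectrum: $$\Lambda_p=\Big\{\lambda\in\mathbb{C}:\ \det\big[\lambda\,\mathrm{Id}-\sum_m e^{im\varphi}M_m(p)\big]=0,\ \varphi\in[0,2\pi)\Big\}.$$ It generically consists of one or several closed curves $\lambda_p(\varphi)$ parametrized by $\varphi$; the bifurcation value is $p=0$. That $\varphi_0$ is a regular point of $\Lambda_0$ means that $\lambda_0(\varphi)$ exists and is locally differentiable in a small neighborhood of $\varphi_0$. Notation: $$L_0=\sum_m e^{im\varphi_0}M_m(0),\quad L_1=\sum_m me^{im\varphi_0}M_m(0),\quad L_2=\sum_m m^2e^{im\varphi_0}M_m(0),\quad L_K=\sum_m e^{im\varphi_0}K_m.$$ $v_0$ and $v_1$ denote the eigenvector and the adjoint eigenvector to the critical eigenvalue $i\omega_0$: $$[i\omega_0\mathrm{Id}-L_0]v_0=0,\qquad[-i\omega_0\mathrm{Id}-L_0^*]v_1=0,\qquad|v_0|^2=1,\qquad\langle v_0,v_1\rangle=1,$$ where $\langle\cdot,\cdot\rangle$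 is the inner product on $\mathbb{C}^n$ and $L_0^*$ is the adjoint of $L_0$. The vectors $h_1(v_0)$ and $h_2(v_0)$ are determined by the leading (third order) terms in the expansion of the nonlinearity. These are given by expanding $h(y_{j-R},\dots,y_{j+R};0)$ in the homogeneous state $y_m=\alpha v_0+c.c.$, $m=j-R,\dots,j+R$, with respect to $\alpha\in\mathbb{C}$; $h_1(v_0)$ is the coefficient of $\alpha|\alpha|^2$ and $h_2(v_0)$ that of $\alpha^3$. In the expanded equation (after division by $\varepsilon$) they contribute $\varepsilon^2e^{i\omega_0t+i\varphi_0j}A|A|^2h_1(v_0)+\varepsilon^2e^{3i(\omega_0t+\varphi_0j)}A^3h_2(v_0)$, up to complex conjugated terms. Solvability conditions: the ansatz is substituted into the system, the result is divided by $\varepsilon$, and the shifted arguments $x_1+m\varepsilon$ of $A$ are expanded in $\varepsilon$. The solvability condition requires that the different harmonics (terms with $e^{i\omega_0t+i\varphi_0j}$ and with $e^{3i(\omega_0t+\varphi_0j)}$), as well as the different orders of $\varepsilon$ up to $\varepsilon^2$ (i.e. up to $\varepsilon^3$ before the division), are equal on both sides. The first-harmonic equations at orders $\varepsilon^1$ and $\varepsilon^2$ are multiplied with $v_1$ (in the inner product) to obtain scalar equations for $A$. The periodic boundary conditions in $\xi$ are imposed to take the ring structure into account.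
   Formalization: It is assumed that h_1, h_2 are also the cubic coefficients in the plane wave with phase φ_0 (false for general nonlocal h), that the eigenspace of iω_0 is one-dimensional and that A is not identically 0; the formula for v_2 is asserted when the inverse at 3φ_0 exists. *)

theory Defs
  imports "HOL-Analysis.Analysis" "HOL-Library.Landau_Symbols"
begin

(* Hermitian inner product, linear in the first argument.  (The library's inner on complex^'n is
   its real part.) *)
definition cinner :: "complex^'n \<Rightarrow> complex^'n \<Rightarrow> complex" where
  "cinner x y = (\<Sum>i\<in>UNIV. x $ i * cnj (y $ i))"

definition cadjoint :: "complex^'n^'n \<Rightarrow> complex^'n^'n" where
  "cadjoint B = (\<chi> i k. cnj (B $ k $ i))"

(* z + c.c., as a real vector *)
definition plus_cc :: "complex^'n \<Rightarrow> real^'n" where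
  "plus_cc z = (\<chi> i. Re (z $ i + cnj (z $ i)))"

(* sum over |m| <= R of exp(i m \<phi>) B_m *)
definition symbol :: "nat \<Rightarrow> (int \<Rightarrow> real^'n^'n) \<Rightarrow> real \<Rightarrow> complex^'n^'n" where
  "symbol R B \<phi> =
     (\<chi> i k. \<Sum>m\<in>{- int R..int R}. cis (of_int m * \<phi>) * complex_of_real (B m $ i $ k))"

(* The part of the asymptotic continuous spectrum with wave number \<phi>; the spectrum itself is the
   union of these sets over 0 <= \<phi> < 2 pi. *)
definition spectrum_at :: "nat \<Rightarrow> (int \<Rightarrow> real \<Rightarrow> real^'n^'n) \<Rightarrow> real \<Rightarrow> real \<Rightarrow> complex set" where
  "spectrum_at R M p \<phi> = {l. det (mat l - symbol R (\<lambda>m. M m p) \<phi>) = 0}"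

(* lam is the branch \<phi> |-> lambda_0(\<phi>) near \<phi>0 *)
definition regular_point ::
  "nat \<Rightarrow> (int \<Rightarrow> real \<Rightarrow> real^'n^'n) \<Rightarrow> (real \<Rightarrow> complex) \<Rightarrow> real \<Rightarrow> bool" where
  "regular_point R M lam \<phi>0 \<longleftrightarrow>
     eventually (\<lambda>\<phi>. lam \<phi> \<in> spectrum_at R M 0 \<phi> \<and> lam differentiable (at \<phi>)) (nhds \<phi>0)"

(* The nonlinearity takes the 2R+1 states of a stencil.  The type 's indexes the stencil, and
   off s in {-R..R} is the lattice offset of its entry s. *)

definition trilinear :: "('a::real_vector \<Rightarrow> 'a \<Rightarrow> 'a \<Rightarrow> 'b::real_vector) \<Rightarrow> bool" where
  "trilinear T \<longleftrightarrow>
     (\<forall>y z. linear (\<lambda>x. T x y z)) \<and> (\<forall>x z. linear (\<lambda>y. T x y z)) \<and> (\<forall>x y. linear (\<lambda>z. T x y z))"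

(* The Taylor expansion of h at the origin starts with cubic terms, uniformly for p near 0. *)
definition third_order :: "(real^'n^'s \<Rightarrow> real \<Rightarrow> real^'n) \<Rightarrow> bool" where
  "third_order h \<longleftrightarrow> (\<exists>T. trilinear T \<and>
     (\<lambda>(y, p). norm (h y p - T y y y)) \<in> o[nhds (0, 0)](\<lambda>(y, p). norm y ^ 3))"

(* h1 and h2 are the coefficients of \<alpha>|\<alpha>|^2 and \<alpha>^3 in the expansion of h(.;0) in the state
   y_m = \<alpha> exp(i m \<phi>) v0 + c.c.; the homogeneous state is the case \<phi> = 0. *)
definition cubic_coefficients ::
  "(real^'n^'s \<Rightarrow> real \<Rightarrow> real^'n) \<Rightarrow> ('s \<Rightarrow> int) \<Rightarrow> complex^'n \<Rightarrow> real \<Rightarrow>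
     complex^'n \<Rightarrow> complex^'n \<Rightarrow> bool" where
  "cubic_coefficients h off v0 \<phi> h1 h2 \<longleftrightarrow>
     (\<lambda>\<alpha>::complex. norm
        (h (\<chi> s. plus_cc ((\<alpha> * cis (of_int (off s) * \<phi>)) *s v0)) 0
         - plus_cc ((\<alpha> * of_real (norm \<alpha> ^ 2)) *s h1 + (\<alpha> ^ 3) *s h2)))
      \<in> o[at 0](\<lambda>\<alpha>. norm \<alpha> ^ 3)"

(* Right-hand side of the equation for one oscillator; y m is the state of its m-th neighbour. *)
definition network_rhs ::
  "nat \<Rightarrow> (int \<Rightarrow> real \<Rightarrow> real^'n^'n) \<Rightarrow> (real^'n^'s \<Rightarrow> real \<Rightarrow> real^'n) \<Rightarrow> ('s \<Rightarrow> int) \<Rightarrow>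
     real \<Rightarrow> (int \<Rightarrow> real^'n) \<Rightarrow> real^'n" where
  "network_rhs R M h off p y =
     (\<Sum>m\<in>{- int R..int R}. M m p *v y m) + h (\<chi> s. y (off s)) p"

(* The multiple scale ansatz as a function of the fast phase \<theta> = \<omega>0 t + \<phi>0 j and of the slow
   coordinates T1, x1, T2. *)
definition ansatz ::
  "complex^'n \<Rightarrow> complex^'n \<Rightarrow> (real \<Rightarrow> real \<Rightarrow> real \<Rightarrow> complex) \<Rightarrow> real \<Rightarrow>
     real \<Rightarrow> real \<Rightarrow> real \<Rightarrow> real \<Rightarrow> real^'n" where
  "ansatz v0 v2 A \<epsilon> \<theta> T1 x1 T2 =
     plus_cc ((of_real \<epsilon> * cis \<theta> * A T1 x1 T2) *s v0
              + (of_real (\<epsilon> ^ 3) * cis (3 * \<theta>) * A T1 x1 T2 ^ 3) *s v2)"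

(* The states of the oscillators j + m at time t + s, as prescribed by the ansatz, when oscillator j
   has the coordinates \<theta>, T1, x1, T2 at time t. *)
definition ansatz_lattice ::
  "real \<Rightarrow> real \<Rightarrow> complex^'n \<Rightarrow> complex^'n \<Rightarrow> (real \<Rightarrow> real \<Rightarrow> real \<Rightarrow> complex) \<Rightarrow> real \<Rightarrow>
     real \<Rightarrow> real \<Rightarrow> real \<Rightarrow> real \<Rightarrow> real \<Rightarrow> int \<Rightarrow> real^'n" where
  "ansatz_lattice \<omega>0 \<phi>0 v0 v2 A \<epsilon> \<theta> T1 x1 T2 s m =
     ansatz v0 v2 A \<epsilon> (\<theta> + \<omega>0 * s + \<phi>0 * of_int m) (T1 + \<epsilon> * s) (x1 + \<epsilon> * of_int m)
       (T2 + \<epsilon>\<^sup>2 * s)"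

(* Left-hand side minus right-hand side of the system with p = \<epsilon>^2 r after substitution of the
   ansatz and division by \<epsilon>.  As in the method of multiple scales, the fast phase and the slow
   coordinates are independent variables. *)
definition residual where
  "residual R M h off \<omega>0 \<phi>0 v0 v2 r A \<epsilon> \<theta> T1 x1 T2 =
     (let y = ansatz_lattice \<omega>0 \<phi>0 v0 v2 A \<epsilon> \<theta> T1 x1 T2
      in (vector_derivative (\<lambda>s. y s 0) (at 0) - network_rhs R M h off (\<epsilon>\<^sup>2 * r) (y 0)) /\<^sub>R \<epsilon>)"

(* The coefficient of exp(i k \<theta>) *)
definition harmonic :: "int \<Rightarrow> (real \<Rightarrow> real^'n) \<Rightarrow> complex^'n" where
  "harmonic k f =
     (\<chi> i. integral {0..2 * pi} (\<lambda>\<theta>. cis (- of_int k * \<theta>) * complex_of_real (f \<theta> $ i))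
            / of_real (2 * pi))"

(* In the residual with \<epsilon> = 1/N, all orders up to \<epsilon>^2 vanish in the first harmonic multiplied
   with v1 and in the third harmonic.  The first harmonic is only required to vanish after
   multiplication with v1: for n > 1 its component outside the critical eigendirection is not
   balanced by the ansatz. *)
definition solvability_conditions where
  "solvability_conditions R M h off \<omega>0 \<phi>0 v0 v1 v2 r I J A \<longleftrightarrow>
     (\<forall>T1\<in>I. \<forall>x1. \<forall>T2\<in>J.
        (\<lambda>N. cinner (harmonic 1
               (\<lambda>\<theta>. residual R M h off \<omega>0 \<phi>0 v0 v2 r A (1 / real N) \<theta> T1 x1 T2)) v1)
          \<in> o(\<lambda>N. complex_of_real ((1 / real N)\<^sup>2)) \<and>
        (\<lambda>N. norm (harmonic 3
               (\<lambda>\<theta>. residual R M h off \<omega>0 \<phi>0 v0 v2 r A (1 / real N) \<theta> T1 x1 T2)))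
          \<in> o(\<lambda>N. (1 / real N)\<^sup>2))"

(* The amplitude is jointly differentiable and twice differentiable in x1; I and J are the (open)
   ranges of the slow times T1 and T2. *)
definition smooth_amplitude ::
  "real set \<Rightarrow> real set \<Rightarrow> (real \<Rightarrow> real \<Rightarrow> real \<Rightarrow> complex) \<Rightarrow> bool" where
  "smooth_amplitude I J A \<longleftrightarrow>
     (\<lambda>(T1, x1, T2). A T1 x1 T2) differentiable_on (I \<times> UNIV \<times> J) \<and>
     (\<forall>T1\<in>I. \<forall>T2\<in>J.
        (\<lambda>x. vector_derivative (\<lambda>x1. A T1 x1 T2) (at x)) differentiable_on UNIV)"

(* u_T2 = r k2 u + (k3 / 2) u_xi_xi + zeta u |u|^2  for all xi and all T2 in J *)
definition ginzburg_landau ::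
  "real set \<Rightarrow> real \<Rightarrow> complex \<Rightarrow> complex \<Rightarrow> complex \<Rightarrow> (real \<Rightarrow> real \<Rightarrow> complex) \<Rightarrow> bool" where
  "ginzburg_landau J r \<kappa>2 \<kappa>3 \<zeta> u \<longleftrightarrow>
     (\<exists>u' u''. \<forall>\<xi>. \<forall>T2\<in>J.
        ((\<lambda>x. u x T2) has_vector_derivative u' \<xi> T2) (at \<xi>) \<and>
        ((\<lambda>x. u' x T2) has_vector_derivative u'' \<xi> T2) (at \<xi>) \<and>
        ((\<lambda>\<tau>. u \<xi> \<tau>) has_vector_derivative
           (of_real r * \<kappa>2 * u \<xi> T2 + \<kappa>3 / 2 * u'' \<xi> T2
            + \<zeta> * u \<xi> T2 * of_real (norm (u \<xi> T2) ^ 2))) (at T2))"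

end

theory Submission
  imports Defs
begin

text \<open>Only the nonlinearity enters the residual in a way that is not an explicit trigonometric
  polynomial in the fast phase, and it differs from its cubic part at the unshifted amplitude by
  \<open>o(\<epsilon>\<^sup>3)\<close> uniformly in that phase; so the harmonics of the residual can be read off up to
  \<open>o(\<epsilon>\<^sup>2)\<close>. Pairing the first one with the adjoint eigenvector removes the order \<open>\<epsilon>\<^sup>0\<close>. Order
  \<open>\<epsilon>\<^sup>1\<close> is a transport equation whose speed is the group velocity (perturbation theory of the
  critical eigenvalue), so the amplitude is constant along its characteristics; order \<open>\<epsilon>\<^sup>2\<close> is then
  the Ginzburg-Landau equation in the comoving coordinate. In the third harmonic the amplitude
  factors out as its cube.\<close>

text \<open>Pairing at order \<open>\<epsilon>\<close> produces the speed
  \<open>cinner (L1 *v v0) v1\<close>, a priori a complex number. Only its identification with the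
  real \<open>\<kappa>1\<close> of the bifurcation condition turns that equation into transport
  along real lines.

  The cubic part of \<open>h\<close> is known in two ways: through an abstract trilinear form near
  the origin, uniformly in the parameter, and through \<open>h1\<close>, \<open>h2\<close> along
  plane waves at parameter 0. The form is never split into harmonics. It only carries the estimate
  from the true state at parameter \<open>\<epsilon>\<^sup>2 * r\<close> to the unshifted plane wave
  at parameter 0, where \<open>h1\<close> and \<open>h2\<close> take over.

  The solvability hypothesis for the first harmonic is a single little-o statement along \<epsilon>
  = 1/N at each slow point. The slow point is therefore kept fixed, and the coefficients of
  different orders are separated by their growth in N. Only the fast phase needs uniform bounds,
  because the harmonics integrate over it.\<close>

section \<open>Hermitian product, complexified matrices and complex conjugated terms\<close>

lemma cinner_add_left: "cinner (x + y) z = cinner x z + cinner y z"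
  by (simp add: cinner_def sum.distrib algebra_simps)

lemma cinner_diff_left: "cinner (x - y) z = cinner x z - cinner y z"
  by (simp add: cinner_def sum_subtractf algebra_simps)

lemma cinner_scale_left: "cinner (c *s x) z = c * cinner x z"
  by (simp add: cinner_def sum_distrib_left algebra_simps)

lemma cinner_sum_left: "cinner (\<Sum>m\<in>S. f m) z = (\<Sum>m\<in>S. cinner (f m) z)"
  by (simp add: cinner_def sum_distrib_right sum.swap[of _ S])

lemma cinner_adjoint: "cinner (B *v x) y = cinner x (cadjoint B *v y)"
proof -
  have "cinner (B *v x) y = (\<Sum>i\<in>UNIV. \<Sum>k\<in>UNIV. B $ i $ k * x $ k * cnj (y $ i))"
    by (simp add: cinner_def matrix_vector_mult_def sum_distrib_right)
  also have "\<dots> = (\<Sum>k\<in>UNIV. \<Sum>i\<in>UNIV. B $ i $ k * x $ k * cnj (y $ i))"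
    by (rule sum.swap)
  also have "\<dots> = cinner x (cadjoint B *v y)"
    by (simp add: cinner_def matrix_vector_mult_def cadjoint_def sum_distrib_left algebra_simps)
  finally show ?thesis .
qed

lemma tendsto_cinner [tendsto_intros]:
  assumes "(f \<longlongrightarrow> x) F"
  shows "((\<lambda>t. cinner (f t) y) \<longlongrightarrow> cinner x y) F"
  unfolding cinner_def by (intro tendsto_intros assms)

lemma norm_vector_scale: "norm (c *s x) = norm c * norm (x :: complex^'n)"
  by (simp add: norm_vec_def L2_set_def norm_mult power_mult_distrib real_sqrt_mult
      flip: sum_distrib_left)

lemma mat_mult_vector: "mat c *v x = c *s (x :: complex^'n)"
  by (simp add: vec_eq_iff matrix_vector_mult_def mat_def if_distrib[where f="\<lambda>z. z * _"] cong: if_cong)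

text \<open>The couplings are real while the ansatz is written with complex vectors; with this
  complexification a real matrix can be moved inside \<open>plus_cc\<close>.\<close>

definition cmat :: "real^'n^'n \<Rightarrow> complex^'n^'n" where
  "cmat B = (\<chi> i k. complex_of_real (B $ i $ k))"

lemma symbol_mult_vector:
  "symbol R B \<phi> *v x = (\<Sum>m\<in>{- int R..int R}. cis (of_int m * \<phi>) *s (cmat (B m) *v x))"
proof (rule vec_eq_iff[THEN iffD2], rule allI)
  fix i
  have "(symbol R B \<phi> *v x) $ i
     = (\<Sum>k\<in>UNIV. \<Sum>m\<in>{- int R..int R}. cis (of_int m * \<phi>) * complex_of_real (B m $ i $ k) * x $ k)"
    by (simp add: symbol_def matrix_vector_mult_def sum_distrib_right)
  also have "\<dots> = (\<Sum>m\<in>{- int R..int R}. \<Sum>k\<in>UNIV. cis (of_int m * \<phi>) * complex_of_real (B m $ i $ k) * x $ k)"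
    by (rule sum.swap)
  finally show "(symbol R B \<phi> *v x) $ i
     = (\<Sum>m\<in>{- int R..int R}. cis (of_int m * \<phi>) *s (cmat (B m) *v x)) $ i"
    by (simp add: matrix_vector_mult_def cmat_def sum_distrib_left algebra_simps)
qed

lemma cmat_scaleR: "cmat (c *\<^sub>R B) *v x = of_real c *s (cmat B *v x)"
  by (simp add: vec_eq_iff matrix_vector_mult_def cmat_def sum_distrib_left algebra_simps)

lemma bounded_linear_cmat: "bounded_linear (\<lambda>B. cmat B *v x)"
  by (intro linear_conv_bounded_linear[THEN iffD1] linearI)
     (simp_all add: vec_eq_iff matrix_vector_mult_def cmat_def sum.distrib sum_distrib_left
       algebra_simps scaleR_sum_right scaleR_conv_of_real[where 'a=complex])

lemma bounded_linear_plus_cc: "bounded_linear plus_cc"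
  by (intro linear_conv_bounded_linear[THEN iffD1] linearI)
     (simp_all add: vec_eq_iff plus_cc_def)

lemma norm_plus_cc_le: "norm (plus_cc z) \<le> 2 * norm z"
proof -
  have "norm (plus_cc z) \<le> L2_set (\<lambda>i. 2 * norm (z $ i)) UNIV"
    unfolding norm_vec_def
    by (intro L2_set_mono) (auto simp: plus_cc_def abs_mult abs_Re_le_cmod)
  also have "\<dots> = 2 * norm z"
    by (simp add: norm_vec_def L2_set_right_distrib)
  finally show ?thesis .
qed

lemma matrix_mult_plus_cc: "B *v plus_cc z = plus_cc (cmat B *v z)"
  by (simp add: vec_eq_iff plus_cc_def cmat_def matrix_vector_mult_def sum.distrib
      sum_distrib_left sum_distrib_right algebra_simps)

section \<open>Fourier coefficients in the fast phase\<close>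

lemma integral_cis:
  fixes k :: int
  shows "integral {0..2 * pi} (\<lambda>\<theta>. cis (of_int k * \<theta>)) = (if k = 0 then of_real (2 * pi) else 0)"
proof (cases "k = 0")
  case True
  then show ?thesis by (simp add: scaleR_conv_of_real)
next
  case False
  have "((\<lambda>\<theta>. cis (of_int k * \<theta>) / (\<i> * of_int k)) has_vector_derivative cis (of_int k * \<theta>))
      (at \<theta> within S)" for \<theta> S
    using False by (auto intro!: derivative_eq_intros has_vector_derivative_real_field
        simp: has_vector_derivative_def scaleR_conv_of_real field_simps)
  then have "((\<lambda>\<theta>. cis (of_int k * \<theta>)) has_integral
      (cis (of_int k * (2 * pi)) / (\<i> * of_int k) - cis (of_int k * 0) / (\<i> * of_int k))) {0..2 * pi}"
    by (intro fundamental_theorem_of_calculus) auto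
  moreover have "cis (of_int k * (2 * pi)) = 1"
    using cis_multiple_2pi[of "of_int k"] by (simp add: mult_ac)
  ultimately show ?thesis using False by (simp add: integral_unique)
qed

text \<open>The conjugated terms have frequencies -1 and -3, so orthogonality keeps them out of the
  coefficients at 1 and 3.\<close>

lemma harmonic_trigonometric:
  fixes a b :: "complex^'n"
  shows "harmonic 1 (\<lambda>\<theta>. plus_cc (cis \<theta> *s a + cis (3 * \<theta>) *s b)) = a"
    and "harmonic 3 (\<lambda>\<theta>. plus_cc (cis \<theta> *s a + cis (3 * \<theta>) *s b)) = b"
proof -
  \<comment> \<open>Stated for arbitrary \<open>k\<close>, with all four frequencies listed, so that
    one computation serves both harmonics.\<close>
  have *: "integral {0..2 * pi} (\<lambda>\<theta>. cis (- of_int k * \<theta>)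
        * complex_of_real (plus_cc (cis \<theta> *s a + cis (3 * \<theta>) *s b) $ i))
      = of_real (2 * pi) * ((if k = 1 then a $ i else 0) + (if k = 3 then b $ i else 0)
        + (if k = -1 then cnj (a $ i) else 0) + (if k = -3 then cnj (b $ i) else 0))" for k :: int and i
  proof -
    have "cis (- of_int k * \<theta>) * complex_of_real (plus_cc (cis \<theta> *s a + cis (3 * \<theta>) *s b) $ i)
        = a $ i * cis (of_int (1 - k) * \<theta>) + b $ i * cis (of_int (3 - k) * \<theta>)
          + cnj (a $ i) * cis (of_int (- 1 - k) * \<theta>) + cnj (b $ i) * cis (of_int (- 3 - k) * \<theta>)" for \<theta>
    proof -
      have "complex_of_real (plus_cc z $ i) = z $ i + cnj (z $ i)" for z :: "complex^'n"
        by (simp add: plus_cc_def complex_eq_iff)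
      then have "cis (- of_int k * \<theta>) * complex_of_real (plus_cc (cis \<theta> *s a + cis (3 * \<theta>) *s b) $ i)
        = cis (- of_int k * \<theta>) * (a $ i * cis \<theta> + b $ i * cis (3 * \<theta>)
          + cnj (a $ i) * cis (- \<theta>) + cnj (b $ i) * cis (- (3 * \<theta>)))"
        by (simp add: cis_cnj)
      also have "\<dots> = a $ i * (cis (- of_int k * \<theta>) * cis \<theta>)
          + b $ i * (cis (- of_int k * \<theta>) * cis (3 * \<theta>))
          + cnj (a $ i) * (cis (- of_int k * \<theta>) * cis (- \<theta>))
          + cnj (b $ i) * (cis (- of_int k * \<theta>) * cis (- (3 * \<theta>)))"
        by (simp add: algebra_simps)
      finally show ?thesis unfolding cis_mult by (simp add: algebra_simps minus_diff_commute)
    qed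
    then show ?thesis
      by (simp only:) (subst integral_add integral_mult_right integral_cis |
         intro integrable_continuous_interval continuous_intros |
         simp split: if_splits)+
  qed
  show "harmonic 1 (\<lambda>\<theta>. plus_cc (cis \<theta> *s a + cis (3 * \<theta>) *s b)) = a"
    and "harmonic 3 (\<lambda>\<theta>. plus_cc (cis \<theta> *s a + cis (3 * \<theta>) *s b)) = b"
    unfolding harmonic_def * by (simp_all add: vec_eq_iff)
qed

lemma continuous_harmonic_integrand:
  assumes "continuous_on {0..2 * pi} f"
  shows "(\<lambda>\<theta>. cis (- of_int k * \<theta>) * complex_of_real (f \<theta> $ i)) integrable_on {0..2 * pi}"
  by (intro integrable_continuous_interval continuous_intros assms)

lemma harmonic_diff:
  assumes "continuous_on {0..2 * pi} f" "continuous_on {0..2 * pi} g"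
  shows "harmonic k (\<lambda>\<theta>. f \<theta> - g \<theta>) = harmonic k f - harmonic k g"
proof -
  have "integral {0..2 * pi} (\<lambda>\<theta>. cis (- of_int k * \<theta>) * complex_of_real ((f \<theta> - g \<theta>) $ i))
      = integral {0..2 * pi} (\<lambda>\<theta>. cis (- of_int k * \<theta>) * complex_of_real (f \<theta> $ i))
        - integral {0..2 * pi} (\<lambda>\<theta>. cis (- of_int k * \<theta>) * complex_of_real (g \<theta> $ i))" for i
    using integral_diff[OF continuous_harmonic_integrand[OF assms(1), of k i]
        continuous_harmonic_integrand[OF assms(2), of k i]]
    by (simp add: right_diff_distrib)
  then show ?thesis
    unfolding harmonic_def by (simp add: vec_eq_iff diff_divide_distrib)
qed

text \<open>The factor \<open>CARD('n)\<close> comes from bounding the Euclidean norm by the sum of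
  the components. Its size is irrelevant; what counts is that a bound uniform in the phase passes
  linearly to the harmonic.\<close>

lemma norm_harmonic_le:
  fixes f :: "real \<Rightarrow> real^'n" and c :: real
  assumes "continuous_on {0..2 * pi} f" and "\<And>\<theta>. norm (f \<theta>) \<le> c"
  shows "norm (harmonic k f) \<le> CARD('n) * c"
proof -
  have "norm (harmonic k f $ i) \<le> c" for i
  proof -
    have "norm (integral {0..2 * pi} (\<lambda>\<theta>. cis (- of_int k * \<theta>) * complex_of_real (f \<theta> $ i)))
        \<le> c * (2 * pi - 0)"
    proof (rule integral_bound)
      show "norm (cis (- of_int k * \<theta>) * complex_of_real (f \<theta> $ i)) \<le> c" for \<theta>
        using assms(2)[of \<theta>] component_le_norm_cart[of "f \<theta>" i] by (simp add: norm_mult)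
    qed (auto intro!: continuous_intros assms)
    then show ?thesis by (simp add: harmonic_def norm_divide divide_le_eq)
  qed
  then have "(\<Sum>i\<in>UNIV. norm (harmonic k f $ i)) \<le> CARD('n) * c"
    using sum_bounded_above[of UNIV "\<lambda>i. norm (harmonic k f $ i)" c] by simp
  then show ?thesis unfolding norm_vec_def
    by (metis (no_types, lifting) L2_set_le_sum norm_ge_zero order_trans)
qed

section \<open>First order perturbation of the critical eigenvalue\<close>

lemma tendsto_matrix_vector_mult [tendsto_intros]:
  fixes B :: "complex^'n^'m"
  assumes "(f \<longlongrightarrow> x) F"
  shows "((\<lambda>t. B *v f t) \<longlongrightarrow> B *v x) F"
  unfolding matrix_vector_mult_def by (intro tendsto_intros assms)

lemma tendsto_vector_scale [tendsto_intros]: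
  fixes f :: "'t \<Rightarrow> complex" and x :: "complex^'n"
  assumes "(f \<longlongrightarrow> c) F" and "(g \<longlongrightarrow> x) F"
  shows "((\<lambda>t. f t *s g t) \<longlongrightarrow> c *s x) F"
  unfolding vector_scalar_mult_def by (intro tendsto_intros assms)

lemma has_vector_derivative_quotient:
  assumes "(f has_vector_derivative d) (at x)"
  shows "((\<lambda>h. (f (x + h) - f x) /\<^sub>R h) \<longlongrightarrow> d) (at 0)"
proof -
  have "(\<lambda>h. norm (f (x + h) - f x - h *\<^sub>R d) / norm h) \<midarrow>0\<rightarrow> 0"
    using assms by (simp add: has_vector_derivative_def has_derivative_at)
  moreover have "\<forall>\<^sub>F h in at 0. norm (f (x + h) - f x - h *\<^sub>R d) / norm h
      = norm ((f (x + h) - f x) /\<^sub>R h - d)"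
  proof (rule eventually_mono[OF eventually_neq_at_within[of 0]])
    fix h :: real assume "h \<noteq> 0"
    then have "(f (x + h) - f x) /\<^sub>R h - d = (f (x + h) - f x - h *\<^sub>R d) /\<^sub>R h"
      by (simp add: scaleR_diff_right)
    then show "norm (f (x + h) - f x - h *\<^sub>R d) / norm h = norm ((f (x + h) - f x) /\<^sub>R h - d)"
      by (simp add: divide_inverse mult.commute)
  qed
  ultimately have "(\<lambda>h. norm ((f (x + h) - f x) /\<^sub>R h - d)) \<midarrow>0\<rightarrow> 0"
    by (rule Lim_transform_eventually)
  then show ?thesis by (simp add: LIM_zero_iff tendsto_norm_zero_iff)
qed

text \<open>The kernel vector is normalised so that compactness of the unit sphere can be applied to
  a sequence of such vectors.\<close>

lemma det_zero_kernel:
  fixes B :: "complex^'n^'n"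
  assumes "det B = 0"
  obtains w where "norm w = 1" "B *v w = 0"
proof -
  have "\<not> invertible B" using assms invertible_det_nz[of B] by simp
  then have "\<not> (\<exists>C. C ** B = mat 1)"
    by (metis invertible_def matrix_left_right_inverse)
  then obtain x where x: "B *v x = 0" "x \<noteq> 0" using matrix_left_invertible_ker[of B] by auto
  have "B *v (of_real (inverse (norm x)) *s x) = of_real (inverse (norm x)) *s (B *v x)"
    by (simp add: vector_scalar_commute)
  moreover have "norm (of_real (inverse (norm x)) *s x) = 1"
    using x(2) by (simp add: norm_vector_scale norm_inverse)
  ultimately show thesis using x(1) that[of "of_real (inverse (norm x)) *s x"] by simp
qed

text \<open>The kernel vectors of the perturbed matrices need not depend continuously on the wave number,
  but a subsequence of them converges to a multiple of the critical eigenvector, which is all that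
  the first order perturbation formula requires.\<close>

lemma group_velocity_eq:
  fixes M :: "int \<Rightarrow> real \<Rightarrow> real^'n^'n" and v0 v1 :: "complex^'n"
  assumes branch: "regular_point R M lam \<phi>0"
    and critical: "lam \<phi>0 = \<mu>"
    and deriv: "(lam has_vector_derivative \<i> * \<kappa>) (at \<phi>0)"
    and simple: "\<And>w. symbol R (\<lambda>m. M m 0) \<phi>0 *v w = \<mu> *s w \<Longrightarrow> \<exists>c. w = c *s v0"
    and v0: "symbol R (\<lambda>m. M m 0) \<phi>0 *v v0 = \<mu> *s v0"
    and left: "\<And>w. cinner (symbol R (\<lambda>m. M m 0) \<phi>0 *v w) v1 = \<mu> * cinner w v1"
    and one: "cinner v0 v1 = 1"
  shows "\<kappa> = cinner (symbol R (\<lambda>m. real_of_int m *\<^sub>R M m 0) \<phi>0 *v v0) v1"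
proof -
  define S where "S = symbol R (\<lambda>m. M m 0)"
  define G where "G m w = cinner (cmat (M m 0) *v w) v1" for m and w :: "complex^'n"
  define Z where "Z = {- int R..int R}"
  have S: "S \<phi> *v w = (\<Sum>m\<in>Z. cis (of_int m * \<phi>) *s (cmat (M m 0) *v w))" for \<phi> w
    by (simp add: S_def Z_def symbol_mult_vector)
  have cinner_S: "cinner (S \<phi> *v w) v1 = (\<Sum>m\<in>Z. cis (of_int m * \<phi>) * G m w)" for \<phi> w
    by (simp add: S cinner_sum_left cinner_scale_left G_def)
  obtain \<delta> where "\<delta> > 0" and \<delta>: "\<And>\<phi>. dist \<phi> \<phi>0 < \<delta> \<Longrightarrow> lam \<phi> \<in> spectrum_at R M 0 \<phi>"
    using branch unfolding regular_point_def eventually_nhds_metric by blast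
  \<comment> \<open>The offset 2 keeps \<open>s k\<close> strictly below \<open>\<delta>\<close>
    already at \<open>k = 0\<close>.\<close>
  define s where "s k = \<delta> / (real k + 2)" for k
  have s: "s k > 0" "s k < \<delta>" for k
    using \<open>\<delta> > 0\<close> by (auto simp: s_def divide_less_eq add_pos_pos intro: add_nonneg_pos)
  have "s \<longlonglongrightarrow> 0"
    using LIMSEQ_ignore_initial_segment[OF lim_const_over_n[of \<delta>], of 2] by (simp add: s_def[abs_def] add.commute)
  have "\<exists>w. norm w = 1 \<and> S (\<phi>0 + s k) *v w = lam (\<phi>0 + s k) *s w" for k
  proof -
    have "det (mat (lam (\<phi>0 + s k)) - S (\<phi>0 + s k)) = 0"
      using \<delta>[of "\<phi>0 + s k"] s[of k] by (simp add: spectrum_at_def S_def dist_real_def)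
    then show ?thesis
      by (rule det_zero_kernel) (auto simp: matrix_vector_mult_diff_rdistrib mat_mult_vector)
  qed
  then obtain w where w: "\<And>k. norm (w k) = 1" "\<And>k. S (\<phi>0 + s k) *v w k = lam (\<phi>0 + s k) *s w k"
    by metis
  obtain l q where l: "norm l = 1" and q: "strict_mono q" and lim: "(w \<circ> q) \<longlonglongrightarrow> l"
    using compact_sphere[of "0 :: complex^'n" 1] w(1) unfolding compact_def by (force simp: dist_norm)
  define t where "t k = s (q k)" for k
  have t: "t k \<noteq> 0" for k using s(1)[of "q k"] by (simp add: t_def)
  have "t \<longlonglongrightarrow> 0"
    using LIMSEQ_subseq_LIMSEQ[OF \<open>s \<longlonglongrightarrow> 0\<close> q] by (simp add: t_def[abs_def] o_def)
  then have tf: "filterlim t (at 0) sequentially" using t by (simp add: filterlim_at)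
  define x where "x k = w (q k)" for k
  have x: "x \<longlonglongrightarrow> l" using lim by (simp add: x_def[abs_def] o_def)
  have eig: "S (\<phi>0 + t k) *v x k = lam (\<phi>0 + t k) *s x k" for k
    using w(2) by (simp add: t_def x_def)
  have "isCont lam \<phi>0" using deriv has_vector_derivative_continuous by blast
  then have "(\<lambda>k. lam (\<phi>0 + t k)) \<longlonglongrightarrow> \<mu>"
    using \<open>t \<longlonglongrightarrow> 0\<close> critical
    by (intro isCont_tendsto_compose[where g=lam and F=sequentially and f="\<lambda>k. \<phi>0 + t k" and l=\<phi>0, THEN tendsto_eq_rhs])
       (auto intro!: tendsto_eq_intros)
  then have "(\<lambda>k. S (\<phi>0 + t k) *v x k) \<longlonglongrightarrow> \<mu> *s l"
    unfolding eig by (intro tendsto_intros x)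
  moreover have "(\<lambda>k. S (\<phi>0 + t k) *v x k) \<longlonglongrightarrow> S \<phi>0 *v l"
    unfolding S using \<open>t \<longlonglongrightarrow> 0\<close> x by (auto intro!: tendsto_eq_intros)
  ultimately have "S \<phi>0 *v l = \<mu> *s l" using LIMSEQ_unique by blast
  \<comment> \<open>The limit lies in the critical eigenspace, which is spanned by
    \<open>v0\<close>. The factor \<open>c\<close> is unknown but nonzero, as \<open>l\<close> has
    norm 1, and it cancels at the end.\<close>
  then obtain c where c: "l = c *s v0" using simple unfolding S_def by blast
  have "c \<noteq> 0" using l c by auto
  \<comment> \<open>Pairing with the left eigenvector moves \<open>S \<phi>0\<close> off the varying
    vector \<open>x k\<close>. The difference quotient then falls on \<open>lam\<close> and on the
    phase factors only, and \<open>x k\<close> merely has to converge.\<close>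
  have quot: "((lam (\<phi>0 + t k) - lam \<phi>0) /\<^sub>R t k) * cinner (x k) v1
      = (\<Sum>m\<in>Z. ((cis (of_int m * (\<phi>0 + t k)) - cis (of_int m * \<phi>0)) /\<^sub>R t k) * G m (x k))" for k
  proof -
    have "(lam (\<phi>0 + t k) - \<mu>) * cinner (x k) v1
        = cinner (S (\<phi>0 + t k) *v x k) v1 - cinner (S \<phi>0 *v x k) v1"
      using left unfolding S_def[symmetric] by (simp add: eig cinner_scale_left algebra_simps)
    also have "\<dots> = (\<Sum>m\<in>Z. (cis (of_int m * (\<phi>0 + t k)) - cis (of_int m * \<phi>0)) * G m (x k))"
      by (simp add: cinner_S sum_subtractf left_diff_distrib)
    finally show ?thesis using critical by (simp add: scaleR_sum_right flip: scaleR_right_distrib)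
  qed
  have "(\<lambda>k. ((lam (\<phi>0 + t k) - lam \<phi>0) /\<^sub>R t k) * cinner (x k) v1) \<longlonglongrightarrow> \<i> * \<kappa> * cinner l v1"
    by (intro tendsto_intros x filterlim_compose[OF has_vector_derivative_quotient[OF deriv] tf])
  moreover have "(\<lambda>k. \<Sum>m\<in>Z. ((cis (of_int m * (\<phi>0 + t k)) - cis (of_int m * \<phi>0)) /\<^sub>R t k) * G m (x k))
      \<longlonglongrightarrow> (\<Sum>m\<in>Z. of_int m * \<i> * cis (of_int m * \<phi>0) * G m l)"
  proof (intro tendsto_sum tendsto_mult)
    fix m
    have "((\<lambda>\<phi>. cis (of_int m * \<phi>)) has_vector_derivative of_int m * \<i> * cis (of_int m * \<phi>0)) (at \<phi>0)"
      by (auto intro!: derivative_eq_intros simp: has_vector_derivative_def scaleR_conv_of_real)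
    from filterlim_compose[OF has_vector_derivative_quotient[OF this] tf]
    show "(\<lambda>k. (cis (of_int m * (\<phi>0 + t k)) - cis (of_int m * \<phi>0)) /\<^sub>R t k)
        \<longlonglongrightarrow> of_int m * \<i> * cis (of_int m * \<phi>0)" .
    show "(\<lambda>k. G m (x k)) \<longlonglongrightarrow> G m l" unfolding G_def by (intro tendsto_intros x)
  qed
  ultimately have "\<i> * \<kappa> * cinner l v1 = (\<Sum>m\<in>Z. of_int m * \<i> * cis (of_int m * \<phi>0) * G m l)"
    unfolding quot using LIMSEQ_unique by blast
  also have "\<dots> = \<i> * c * (\<Sum>m\<in>Z. of_int m * cis (of_int m * \<phi>0) * G m v0)"
    unfolding sum_distrib_left c G_def
    by (simp add: vector_scalar_commute cinner_scale_left algebra_simps)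
  finally have "\<kappa> = (\<Sum>m\<in>Z. of_int m * cis (of_int m * \<phi>0) * G m v0)"
    using \<open>c \<noteq> 0\<close> one by (simp add: c cinner_scale_left)
  also have "\<dots> = cinner (symbol R (\<lambda>m. real_of_int m *\<^sub>R M m 0) \<phi>0 *v v0) v1"
    by (simp add: symbol_mult_vector cinner_sum_left cinner_scale_left cmat_scaleR G_def Z_def algebra_simps)
  finally show ?thesis .
qed

section \<open>Taylor expansion and the cubic nonlinearity\<close>

text \<open>Peano form: the second derivative exists only at 0. The remainder \<open>g\<close> has a
  derivative of size o(t), so the mean value inequality, which holds for vector values as well,
  makes \<open>g\<close> itself o(t^2).\<close>

lemma second_order_taylor:
  fixes f f' :: "real \<Rightarrow> 'a::real_normed_vector"
  assumes f: "\<And>y. (f has_vector_derivative f' y) (at y)"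
    and f': "(f' has_vector_derivative f2) (at 0)"
  shows "((\<lambda>t. (f t - f 0 - t *\<^sub>R f' 0) /\<^sub>R t\<^sup>2) \<longlongrightarrow> f2 /\<^sub>R 2) (at 0)"
proof -
  define g where "g t = f t - f 0 - t *\<^sub>R f' 0 - (t\<^sup>2 / 2) *\<^sub>R f2" for t
  have "((\<lambda>t. g t /\<^sub>R t\<^sup>2) \<longlongrightarrow> 0) (at 0)"
  proof (rule LIM_I)
    fix e :: real assume "e > 0"
    then have "\<forall>\<^sub>F t in at 0. norm ((f' (0 + t) - f' 0) /\<^sub>R t - f2) < e / 2"
      using tendstoD[OF has_vector_derivative_quotient[OF f'], of "e / 2"] by (simp add: dist_norm)
    then obtain d where "d > 0" and d: "\<And>t. t \<noteq> 0 \<Longrightarrow> \<bar>t\<bar> < d \<Longrightarrow> norm ((f' t - f' 0) /\<^sub>R t - f2) < e / 2"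
      unfolding eventually_at by (auto simp: dist_norm)
    have deriv_bound: "norm (f' t - f' 0 - t *\<^sub>R f2) \<le> e / 2 * \<bar>t\<bar>" if "\<bar>t\<bar> < d" for t
    proof (cases "t = 0")
      case False
      then have "f' t - f' 0 - t *\<^sub>R f2 = t *\<^sub>R ((f' t - f' 0) /\<^sub>R t - f2)"
        by (simp add: scaleR_diff_right)
      then show ?thesis
        using mult_left_mono[OF less_imp_le[OF d[OF False that]], of "\<bar>t\<bar>"]
        by (simp add: mult.commute)
    qed simp
    have "norm (g h /\<^sub>R h\<^sup>2 - 0) < e" if h: "h \<noteq> 0" "\<bar>h\<bar> < d" for h
    proof -
      have "norm (g h - g 0) \<le> e / 2 * \<bar>h\<bar> * norm (h - 0)"
      proof (rule differentiable_bound)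
        fix t assume "t \<in> closed_segment 0 h"
        then have t: "\<bar>t\<bar> \<le> \<bar>h\<bar>" by (auto simp: closed_segment_eq_real_ivl split: if_splits)
        have "(g has_vector_derivative f' t - f' 0 - t *\<^sub>R f2) (at t)"
          unfolding g_def by (auto intro!: derivative_eq_intros f)
        then show "(g has_derivative (\<lambda>s. s *\<^sub>R (f' t - f' 0 - t *\<^sub>R f2))) (at t within closed_segment 0 h)"
          by (simp add: has_vector_derivative_def has_derivative_at_withinI)
        have "norm (f' t - f' 0 - t *\<^sub>R f2) \<le> e / 2 * \<bar>t\<bar>"
          using t h by (intro deriv_bound) simp
        also have "\<dots> \<le> e / 2 * \<bar>h\<bar>"
          using t \<open>e > 0\<close> by (intro mult_left_mono) auto
        finally have "norm (f' t - f' 0 - t *\<^sub>R f2) \<le> e / 2 * \<bar>h\<bar>" .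
        then have "\<bar>s\<bar> * norm (f' t - f' 0 - t *\<^sub>R f2) \<le> \<bar>s\<bar> * (e / 2 * \<bar>h\<bar>)" for s
          by (rule mult_left_mono) simp
        then have bound: "norm (s *\<^sub>R (f' t - f' 0 - t *\<^sub>R f2)) \<le> e / 2 * \<bar>h\<bar> * norm s" for s :: real
          by (simp add: mult.commute)
        show "onorm (\<lambda>s. s *\<^sub>R (f' t - f' 0 - t *\<^sub>R f2)) \<le> e / 2 * \<bar>h\<bar>"
        proof (rule onorm_le)
          show "norm (s *\<^sub>R (f' t - f' 0 - t *\<^sub>R f2)) \<le> e / 2 * \<bar>h\<bar> * norm s" for s :: real
            by (rule bound)
        qed
      qed auto
      then have "norm (g h) \<le> e / 2 * h\<^sup>2" by (simp add: g_def power2_eq_square abs_mult_self_eq)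
      then have "norm (g h) / h\<^sup>2 \<le> e / 2" using h by (simp add: divide_le_eq)
      moreover have "norm (g h /\<^sub>R h\<^sup>2 - 0) = norm (g h) / h\<^sup>2"
        by (simp add: divide_inverse_commute)
      ultimately show ?thesis using \<open>e > 0\<close> by linarith
    qed
    then show "\<exists>d>0. \<forall>h. h \<noteq> 0 \<and> norm (h - 0) < d \<longrightarrow> norm (g h /\<^sub>R h\<^sup>2 - 0) < e"
      using \<open>d > 0\<close> by auto
  qed
  then have "((\<lambda>t. g t /\<^sub>R t\<^sup>2 + f2 /\<^sub>R 2) \<longlongrightarrow> f2 /\<^sub>R 2) (at 0)"
    using tendsto_add[OF _ tendsto_const[of "f2 /\<^sub>R 2"]] by fastforce
  moreover have "\<forall>\<^sub>F t in at 0. g t /\<^sub>R t\<^sup>2 + f2 /\<^sub>R 2 = (f t - f 0 - t *\<^sub>R f' 0) /\<^sub>R t\<^sup>2"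
    by (rule eventually_mono[OF eventually_neq_at_within[of 0]])
       (simp add: g_def scaleR_diff_right)
  ultimately show ?thesis by (rule Lim_transform_eventually)
qed

text \<open>Expanding the first argument in the basis leaves finitely many bilinear forms, each of
  which is bounded.\<close>

lemma trilinear_bounded:
  fixes T :: "'a::euclidean_space \<Rightarrow> 'a \<Rightarrow> 'a \<Rightarrow> 'b::real_normed_vector"
  assumes "trilinear T"
  obtains B where "B \<ge> 0" "\<And>x y z. norm (T x y z) \<le> B * norm x * norm y * norm z"
proof -
  have "bilinear (T b)" for b
    using assms by (auto simp: trilinear_def bilinear_def)
  then have "\<exists>B. \<forall>y z. norm (T b y z) \<le> B * norm y * norm z" for b
    by (rule bilinear_bounded)
  then obtain C where C: "\<And>b y z. norm (T b y z) \<le> C b * norm y * norm z" by metis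
  have "norm (T x y z) \<le> (\<Sum>b\<in>Basis. \<bar>C b\<bar>) * norm x * norm y * norm z" for x y z
  proof -
    have "linear (\<lambda>x. T x y z)" using assms by (auto simp: trilinear_def)
    then have "T (\<Sum>b\<in>Basis. (x \<bullet> b) *\<^sub>R b) y z = (\<Sum>b\<in>Basis. (x \<bullet> b) *\<^sub>R T b y z)"
      by (subst linear_sum, assumption) (simp add: linear_cmul[of "\<lambda>x. T x y z"])
    then have "T x y z = (\<Sum>b\<in>Basis. (x \<bullet> b) *\<^sub>R T b y z)"
      by (simp add: euclidean_representation)
    also have "norm \<dots> \<le> (\<Sum>b\<in>Basis. \<bar>C b\<bar> * norm x * norm y * norm z)"
    proof (rule sum_norm_le)
      fix b :: 'a assume "b \<in> Basis"
      have "norm (T b y z) \<le> \<bar>C b\<bar> * (norm y * norm z)"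
        using C[of b y z] mult_right_mono[OF abs_ge_self[of "C b"], of "norm y * norm z"]
        by (simp add: mult.assoc)
      then have "\<bar>x \<bullet> b\<bar> * norm (T b y z) \<le> norm x * (\<bar>C b\<bar> * (norm y * norm z))"
        using Basis_le_norm[OF \<open>b \<in> Basis\<close>, of x] by (intro mult_mono) auto
      then show "norm ((x \<bullet> b) *\<^sub>R T b y z) \<le> \<bar>C b\<bar> * norm x * norm y * norm z"
        by (simp add: mult_ac)
    qed
    finally show ?thesis by (simp add: sum_distrib_right)
  qed
  moreover have "(\<Sum>b\<in>(Basis :: 'a set). \<bar>C b\<bar>) \<ge> 0" by (simp add: sum_nonneg)
  ultimately show thesis using that by blast
qed

text \<open>The arguments are exchanged one at a time, giving three terms with \<open>x - y\<close>
  in one slot each; symmetry of \<open>T\<close> is not assumed.\<close>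

lemma trilinear_diagonal_diff:
  fixes T :: "'a::euclidean_space \<Rightarrow> 'a \<Rightarrow> 'a \<Rightarrow> 'b::real_normed_vector"
  assumes T: "trilinear T" and B: "B \<ge> 0" "\<And>x y z. norm (T x y z) \<le> B * norm x * norm y * norm z"
    and D: "norm x \<le> D" "norm y \<le> D"
  shows "norm (T x x x - T y y y) \<le> 3 * B * D\<^sup>2 * norm (x - y)"
proof -
  have "D \<ge> 0" using D(1) norm_ge_zero order_trans by blast
  have l: "linear (\<lambda>a. T a b c)" "linear (\<lambda>a. T b a c)" "linear (\<lambda>a. T b c a)" for b c
    using T by (auto simp: trilinear_def)
  have "T x x x - T y y y = T (x - y) x x + T y (x - y) x + T y y (x - y)"
    using linear_diff[OF l(1)[of x x], of x y] linear_diff[OF l(2)[of y x], of x y]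
      linear_diff[OF l(3)[of y y], of x y] by simp
  also have "norm \<dots> \<le> norm (T (x - y) x x) + norm (T y (x - y) x) + norm (T y y (x - y))"
    by (rule order_trans[OF norm_triangle_ineq]) (simp add: norm_triangle_ineq)
  also have "\<dots> \<le> B * norm (x - y) * D * D + B * norm (x - y) * D * D + B * norm (x - y) * D * D"
  proof (intro add_mono)
    have *: "B * norm (x - y) * a * b \<le> B * norm (x - y) * D * D" if "0 \<le> a" "0 \<le> b" "a \<le> D" "b \<le> D" for a b
      using that B(1) \<open>D \<ge> 0\<close> by (intro mult_mono) auto
    show "norm (T (x - y) x x) \<le> B * norm (x - y) * D * D"
      using B(2)[of "x - y" x x] *[of "norm x" "norm x"] D by simp
    show "norm (T y (x - y) x) \<le> B * norm (x - y) * D * D"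
      using B(2)[of y "x - y" x] *[of "norm y" "norm x"] D by (simp add: mult_ac)
    show "norm (T y y (x - y)) \<le> B * norm (x - y) * D * D"
      using B(2)[of y y "x - y"] *[of "norm y" "norm y"] D by (simp add: mult_ac)
  qed
  finally show ?thesis by (simp add: power2_eq_square mult_ac)
qed

lemma norm_vec_le:
  fixes x :: "'a::real_normed_vector^'s" and c :: real
  assumes "\<And>i. norm (x $ i) \<le> c"
  shows "norm x \<le> CARD('s) * c"
proof -
  have "norm x \<le> (\<Sum>i\<in>UNIV. norm (x $ i))" unfolding norm_vec_def by (rule L2_set_le_sum) simp
  also have "\<dots> \<le> CARD('s) * c" using sum_bounded_above[of UNIV "\<lambda>i. norm (x $ i)" c] assms by simp
  finally show ?thesis .
qed

text \<open>Chain of comparisons: \<open>h\<close> at the true state and parameter, \<open>T\<close>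
  at the true state, \<open>T\<close> at the plane wave, \<open>h\<close> at the plane wave and
  parameter 0, and finally the expression in \<open>h1\<close> and \<open>h2\<close>. One
  \<open>\<delta>\<close> serves all \<open>\<alpha>\<close> with
  \<open>norm \<alpha> \<le> C * \<epsilon>\<close>, hence all phases.\<close>

lemma cubic_nonlinearity_estimate:
  fixes h :: "real^'n^'s \<Rightarrow> real \<Rightarrow> real^'n"
  assumes h: "third_order h" and h_zero: "h 0 0 = 0"
    and cubic: "cubic_coefficients h off v0 \<phi> h1 h2"
    and "c > 0" "C \<ge> 0"
  obtains \<delta> where "\<delta> > 0"
    "\<And>\<epsilon> \<alpha> Y p. 0 < \<epsilon> \<Longrightarrow> \<epsilon> < \<delta> \<Longrightarrow> norm \<alpha> \<le> C * \<epsilon> \<Longrightarrow> \<bar>p\<bar> < \<delta> \<Longrightarrow>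
       norm (Y - (\<chi> s. plus_cc ((\<alpha> * cis (of_int (off s) * \<phi>)) *s v0))) \<le> \<delta> * \<epsilon> \<Longrightarrow>
       norm (h Y p - plus_cc ((\<alpha> * of_real (norm \<alpha> ^ 2)) *s h1 + (\<alpha> ^ 3) *s h2)) \<le> c * \<epsilon> ^ 3"
proof -
  define Y0 :: "complex \<Rightarrow> real^'n^'s" where "Y0 \<alpha> = (\<chi> s. plus_cc ((\<alpha> * cis (of_int (off s) * \<phi>)) *s v0))" for \<alpha>
  define P where "P \<alpha> = plus_cc ((\<alpha> * of_real (norm \<alpha> ^ 2)) *s h1 + (\<alpha> ^ 3) *s h2)" for \<alpha>
  define L where "L = real CARD('s) * (2 * norm v0)"
  have "L \<ge> 0" by (simp add: L_def)
  have Y0: "norm (Y0 \<alpha>) \<le> L * norm \<alpha>" for \<alpha>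
  proof -
    have "norm (Y0 \<alpha> $ s) \<le> 2 * (norm \<alpha> * norm v0)" for s
      using norm_plus_cc_le[of "(\<alpha> * cis (of_int (off s) * \<phi>)) *s v0"]
      by (simp add: Y0_def norm_vector_scale norm_mult)
    from norm_vec_le[OF this] show ?thesis by (simp add: L_def mult_ac)
  qed
  \<comment> \<open>\<open>L * C * \<epsilon>\<close> bounds the plane wave; the extra 1 absorbs the
    deviation \<open>\<delta> * \<epsilon>\<close> of the true state, as \<open>\<delta>\<close>
    will be at most 1.\<close>
  define D where "D = L * C + 1"
  have "D \<ge> 1" using \<open>L \<ge> 0\<close> \<open>C \<ge> 0\<close> by (simp add: D_def)
  obtain T where T: "trilinear T"
      "(\<lambda>(y, p). norm (h y p - T y y y)) \<in> o[nhds (0, 0)](\<lambda>(y, p). norm y ^ 3)"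
    using h unfolding third_order_def by blast
  obtain B where B: "B \<ge> 0" "\<And>x y z. norm (T x y z) \<le> B * norm x * norm y * norm z"
    using trilinear_bounded[OF T(1)] by metis
  have "c / (8 * D ^ 3) > 0" using \<open>c > 0\<close> \<open>D \<ge> 1\<close> by simp
  from landau_o.smallD[OF T(2) this] obtain \<rho> where "\<rho> > 0" and
    \<rho>': "\<And>z. dist z (0, 0) < \<rho> \<Longrightarrow> (case z of (y, p) \<Rightarrow> norm (h y p - T y y y)) \<le> c / (8 * D ^ 3) * (case z of (y, p) \<Rightarrow> norm y ^ 3)"
    unfolding eventually_nhds_metric by (auto simp: split_beta)
  have \<rho>: "norm (h y p - T y y y) \<le> c / 8 * \<epsilon> ^ 3"
    if "norm y \<le> D * \<epsilon>" "D * \<epsilon> < \<rho> / 2" "\<bar>p\<bar> < \<rho> / 2" for y p \<epsilon>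
  proof -
    have "dist (y, p) (0, 0) < \<rho>"
      using norm_Pair_le[of y p] that by (simp add: dist_norm)
    from \<rho>'[OF this] have "norm (h y p - T y y y) \<le> c / (8 * D ^ 3) * norm y ^ 3" by simp
    also have "\<dots> \<le> c / (8 * D ^ 3) * (D * \<epsilon>) ^ 3"
      using that \<open>c > 0\<close> \<open>D \<ge> 1\<close> by (intro mult_left_mono power_mono) auto
    finally show ?thesis using \<open>D \<ge> 1\<close> by (simp add: power_mult_distrib)
  qed
  \<comment> \<open>The summand 1 keeps the denominator positive when \<open>C = 0\<close>, which
    happens at zeros of the amplitude.\<close>
  have "c / (4 * (C ^ 3 + 1)) > 0" using \<open>c > 0\<close> \<open>C \<ge> 0\<close> by (simp add: add_nonneg_pos)
  from landau_o.smallD[OF cubic[unfolded cubic_coefficients_def] this]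
  obtain \<sigma> where "\<sigma> > 0" and
    \<sigma>': "\<And>\<alpha>. \<alpha> \<noteq> 0 \<Longrightarrow> norm \<alpha> < \<sigma> \<Longrightarrow> norm (h (Y0 \<alpha>) 0 - P \<alpha>) \<le> c / (4 * (C ^ 3 + 1)) * norm \<alpha> ^ 3"
    unfolding eventually_at by (auto simp: Y0_def P_def dist_norm norm_power)
  have \<sigma>: "norm (h (Y0 \<alpha>) 0 - P \<alpha>) \<le> c / 4 * \<epsilon> ^ 3"
    if "norm \<alpha> \<le> C * \<epsilon>" "C * \<epsilon> < \<sigma>" "\<epsilon> > 0" for \<alpha> \<epsilon>
  proof (cases "\<alpha> = 0")
    \<comment> \<open>The expansion along plane waves is a statement about the punctured
      neighbourhood of 0, so the zero wave is settled by \<open>h_zero\<close>.\<close>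
    case True
    then have "Y0 \<alpha> = 0" "P \<alpha> = 0" by (simp_all add: Y0_def P_def plus_cc_def vec_eq_iff)
    then show ?thesis using h_zero \<open>c > 0\<close> that by simp
  next
    case False
    then have "norm (h (Y0 \<alpha>) 0 - P \<alpha>) \<le> c / (4 * (C ^ 3 + 1)) * norm \<alpha> ^ 3"
      using \<sigma>' that by simp
    also have "\<dots> \<le> c / (4 * (C ^ 3 + 1)) * (C * \<epsilon>) ^ 3"
      using that \<open>c > 0\<close> \<open>C \<ge> 0\<close> by (intro mult_left_mono power_mono) auto
    also have "\<dots> = c / 4 * \<epsilon> ^ 3 * (C ^ 3 / (C ^ 3 + 1))" by (simp add: power_mult_distrib)
    also have "\<dots> \<le> c / 4 * \<epsilon> ^ 3 * 1"
      using that \<open>c > 0\<close> \<open>C \<ge> 0\<close> by (intro mult_left_mono) (auto simp: divide_le_eq_1 add_nonneg_pos)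
    finally show ?thesis by simp
  qed
  \<comment> \<open>The entries ensure in turn: the state stays within
    \<open>D * \<epsilon>\<close>; state and parameter each stay below \<open>\<rho> / 2\<close>;
    the plane wave amplitude stays below \<open>\<sigma>\<close>; and
    \<open>3 * B * D\<^sup>2 * \<delta>\<close> is at most \<open>c / 4\<close>, whence the
    12.\<close>
  define \<delta> where "\<delta> = Min {1, \<rho> / (2 * D), \<rho> / 2, \<sigma> / (C + 1), c / (12 * (B + 1) * D\<^sup>2)}"
  have \<delta>: "\<delta> \<le> 1" "\<delta> \<le> \<rho> / (2 * D)" "\<delta> \<le> \<rho> / 2" "\<delta> \<le> \<sigma> / (C + 1)" "\<delta> \<le> c / (12 * (B + 1) * D\<^sup>2)"
    unfolding \<delta>_def by (intro Min_le; simp)+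
  have "\<delta> > 0" unfolding \<delta>_def
    using \<open>\<rho> > 0\<close> \<open>\<sigma> > 0\<close> \<open>c > 0\<close> \<open>D \<ge> 1\<close> \<open>C \<ge> 0\<close> \<open>B \<ge> 0\<close> by simp
  show thesis
  proof (rule that[OF \<open>\<delta> > 0\<close>])
    fix \<epsilon> p :: real and \<alpha> :: complex and Y
    assume \<epsilon>: "0 < \<epsilon>" "\<epsilon> < \<delta>" and \<alpha>: "norm \<alpha> \<le> C * \<epsilon>" and p: "\<bar>p\<bar> < \<delta>"
      and "norm (Y - (\<chi> s. plus_cc ((\<alpha> * cis (of_int (off s) * \<phi>)) *s v0))) \<le> \<delta> * \<epsilon>"
    then have Y: "norm (Y - Y0 \<alpha>) \<le> \<delta> * \<epsilon>" by (simp add: Y0_def)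
    have D\<epsilon>: "D * \<epsilon> < \<rho> / 2"
    proof -
      have "D * \<epsilon> < D * \<delta>" using \<epsilon> \<open>D \<ge> 1\<close> by simp
      also have "\<dots> \<le> \<rho> / 2" using \<delta>(2) \<open>D \<ge> 1\<close> by (simp add: le_divide_eq mult_ac)
      finally show ?thesis .
    qed
    have "C * \<epsilon> < \<sigma>"
    proof -
      have "C * \<epsilon> \<le> (C + 1) * \<epsilon>" using \<epsilon> by (simp add: mult_right_mono)
      also have "\<dots> < (C + 1) * \<delta>" using \<epsilon> \<open>C \<ge> 0\<close> by (simp add: mult_strict_left_mono)
      also have "\<dots> \<le> \<sigma>" using \<delta>(4) \<open>C \<ge> 0\<close> by (simp add: le_divide_eq mult.commute)
      finally show ?thesis .
    qed
    have nY0: "norm (Y0 \<alpha>) \<le> L * C * \<epsilon>"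
      using order_trans[OF Y0[of \<alpha>] mult_left_mono[OF \<alpha> \<open>L \<ge> 0\<close>]] by (simp add: mult_ac)
    have "\<delta> * \<epsilon> \<le> \<epsilon>" using \<epsilon> \<delta>(1) by simp
    then have nY: "norm Y \<le> D * \<epsilon>"
      using norm_triangle_sub[of Y "Y0 \<alpha>"] Y nY0 by (simp add: D_def algebra_simps)
    have nY0': "norm (Y0 \<alpha>) \<le> D * \<epsilon>" using nY0 \<epsilon> by (simp add: D_def algebra_simps)
    have "norm (T Y Y Y - T (Y0 \<alpha>) (Y0 \<alpha>) (Y0 \<alpha>)) \<le> 3 * B * (D * \<epsilon>)\<^sup>2 * norm (Y - Y0 \<alpha>)"
      by (rule trilinear_diagonal_diff[OF T(1) B nY nY0'])
    also have "\<dots> \<le> 3 * (B + 1) * (D * \<epsilon>)\<^sup>2 * (\<delta> * \<epsilon>)"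
      using Y B(1) by (intro mult_mono) auto
    also have "\<dots> = 3 * (B + 1) * D\<^sup>2 * \<delta> * \<epsilon> ^ 3"
      by (simp add: power2_eq_square power3_eq_cube mult_ac)
    also have "\<dots> \<le> c / 4 * \<epsilon> ^ 3"
    proof (rule mult_right_mono)
      have "12 * (B + 1) * D\<^sup>2 > 0" using B(1) \<open>D \<ge> 1\<close> by simp
      then show "3 * (B + 1) * D\<^sup>2 * \<delta> \<le> c / 4" using \<delta>(5) by (simp add: pos_le_divide_eq algebra_simps)
    qed (use \<epsilon> in simp)
    finally have 1: "norm (T Y Y Y - T (Y0 \<alpha>) (Y0 \<alpha>) (Y0 \<alpha>)) \<le> c / 4 * \<epsilon> ^ 3" .
    have 2: "norm (h Y p - T Y Y Y) \<le> c / 8 * \<epsilon> ^ 3"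
      using \<rho>[OF nY D\<epsilon>] p \<delta>(3) by simp
    have 3: "norm (h (Y0 \<alpha>) 0 - T (Y0 \<alpha>) (Y0 \<alpha>) (Y0 \<alpha>)) \<le> c / 8 * \<epsilon> ^ 3"
      using \<rho>[OF nY0' D\<epsilon>] \<open>\<rho> > 0\<close> by simp
    have 4: "norm (h (Y0 \<alpha>) 0 - P \<alpha>) \<le> c / 4 * \<epsilon> ^ 3"
      using \<sigma>[OF \<alpha> \<open>C * \<epsilon> < \<sigma>\<close> \<epsilon>(1)] .
    \<comment> \<open>The four errors add up to three quarters of
      \<open>c * \<epsilon> ^ 3\<close>.\<close>
    have "h Y p - P \<alpha> = (h Y p - T Y Y Y) + (T Y Y Y - T (Y0 \<alpha>) (Y0 \<alpha>) (Y0 \<alpha>))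
        - (h (Y0 \<alpha>) 0 - T (Y0 \<alpha>) (Y0 \<alpha>) (Y0 \<alpha>)) + (h (Y0 \<alpha>) 0 - P \<alpha>)" by simp
    also have "norm \<dots> \<le> c / 8 * \<epsilon> ^ 3 + c / 4 * \<epsilon> ^ 3 + c / 8 * \<epsilon> ^ 3 + c / 4 * \<epsilon> ^ 3"
      by (intro order_trans[OF norm_triangle_ineq] order_trans[OF norm_triangle_ineq4] add_mono 1 2 3 4)
    also have "\<dots> \<le> c * \<epsilon> ^ 3" using \<open>c > 0\<close> \<epsilon> by (simp add: field_simps)
    finally show "norm (h Y p - plus_cc ((\<alpha> * of_real (norm \<alpha> ^ 2)) *s h1 + (\<alpha> ^ 3) *s h2)) \<le> c * \<epsilon> ^ 3"
      by (simp add: P_def)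
  qed
qed

section \<open>Parameter dependence of the couplings and separation of orders\<close>

lemma plus_cc_scale: "plus_cc (of_real c *s z) = c *\<^sub>R plus_cc z"
  by (simp add: vec_eq_iff plus_cc_def algebra_simps)

lemma bounded_linear_scale_vector: "bounded_linear (\<lambda>c. c *s (v :: complex^'n))"
  by (intro linear_conv_bounded_linear[THEN iffD1] linearI)
     (simp_all add: vec_eq_iff scaleR_conv_of_real[where 'a=complex] algebra_simps)

text \<open>With parameter \<open>\<epsilon>\<^sup>2 * r\<close> the quadratic remainder is of order
  \<epsilon>^4, which vanishes after division by \<open>\<epsilon>\<^sup>2\<close>.\<close>

lemma cmat_quotient_tendsto:
  fixes M :: "real \<Rightarrow> real^'n^'n"
  assumes "(\<lambda>p. norm (M p - M 0 - p *\<^sub>R K)) \<in> O[at 0](\<lambda>p. p\<^sup>2)"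
  shows "((\<lambda>\<epsilon>. (cmat (M (\<epsilon>\<^sup>2 * r)) *v w - cmat (M 0) *v w) /\<^sub>R \<epsilon>\<^sup>2) \<longlongrightarrow> cmat (r *\<^sub>R K) *v w) (at_right 0)"
proof -
  obtain c where "c > 0" and c: "\<forall>\<^sub>F p in at 0. norm (norm (M p - M 0 - p *\<^sub>R K)) \<le> c * norm (p\<^sup>2)"
    using assms by (elim landau_o.bigE)
  obtain d where "d > 0" and d: "\<And>p. p \<noteq> 0 \<Longrightarrow> \<bar>p\<bar> < d \<Longrightarrow> norm (M p - M 0 - p *\<^sub>R K) \<le> c * p\<^sup>2"
    using c unfolding eventually_at by (auto simp: dist_norm)
  \<comment> \<open>The point 0, absent from \<open>at 0\<close>, is added because the parameter
    vanishes identically when \<open>r = 0\<close>.\<close>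
  have d: "norm (M p - M 0 - p *\<^sub>R K) \<le> c * p\<^sup>2" if "\<bar>p\<bar> < d" for p
    using d[of p] that by (cases "p = 0") auto
  have small: "\<forall>\<^sub>F \<epsilon> in at_right (0::real). \<bar>\<epsilon>\<^sup>2 * r\<bar> < d"
  proof -
    have "((\<lambda>\<epsilon>. \<bar>\<epsilon>\<^sup>2 * r\<bar>) \<longlongrightarrow> 0) (at_right 0)" by (auto intro!: tendsto_eq_intros)
    then show ?thesis using \<open>d > 0\<close> by (rule order_tendstoD(2))
  qed
  have "((\<lambda>\<epsilon>. (M (\<epsilon>\<^sup>2 * r) - M 0) /\<^sub>R \<epsilon>\<^sup>2 - r *\<^sub>R K) \<longlongrightarrow> 0) (at_right 0)"
  proof (rule Lim_null_comparison)
    show "((\<lambda>\<epsilon>. c * (\<epsilon>\<^sup>2 * r\<^sup>2)) \<longlongrightarrow> 0) (at_right 0)" by (auto intro!: tendsto_eq_intros)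
    show "\<forall>\<^sub>F \<epsilon> in at_right 0. norm ((M (\<epsilon>\<^sup>2 * r) - M 0) /\<^sub>R \<epsilon>\<^sup>2 - r *\<^sub>R K) \<le> c * (\<epsilon>\<^sup>2 * r\<^sup>2)"
      using small eventually_at_right_less
    proof eventually_elim
      case (elim \<epsilon>)
      then have "norm ((M (\<epsilon>\<^sup>2 * r) - M 0) /\<^sub>R \<epsilon>\<^sup>2 - r *\<^sub>R K)
          = norm ((M (\<epsilon>\<^sup>2 * r) - M 0 - (\<epsilon>\<^sup>2 * r) *\<^sub>R K) /\<^sub>R \<epsilon>\<^sup>2)"
        by (simp add: scaleR_diff_right mult.assoc[symmetric])
      also have "\<dots> = norm (M (\<epsilon>\<^sup>2 * r) - M 0 - (\<epsilon>\<^sup>2 * r) *\<^sub>R K) / \<epsilon>\<^sup>2"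
        by (simp add: divide_inverse mult.commute)
      also have "\<dots> \<le> c * (\<epsilon>\<^sup>2 * r)\<^sup>2 / \<epsilon>\<^sup>2"
        using d elim by (intro divide_right_mono) auto
      also have "\<dots> = c * (\<epsilon>\<^sup>2 * r\<^sup>2)" using elim by (simp add: power_mult_distrib power2_eq_square)
      finally show ?case .
    qed
  qed
  then have "((\<lambda>\<epsilon>. (M (\<epsilon>\<^sup>2 * r) - M 0) /\<^sub>R \<epsilon>\<^sup>2) \<longlongrightarrow> r *\<^sub>R K) (at_right 0)"
    by (simp add: LIM_zero_iff)
  from bounded_linear.tendsto[OF bounded_linear_cmat[of w] this]
  show ?thesis
    by (simp only: linear_diff[OF bounded_linear.linear[OF bounded_linear_cmat[of w]]]
        linear_cmul[OF bounded_linear.linear[OF bounded_linear_cmat[of w]]])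
qed

text \<open>After the division the first term is N * \<open>c1\<close>, which cannot be balanced by
  the convergent \<open>q\<close> unless \<open>c1\<close> vanishes; then \<open>q\<close> itself
  tends to 0.\<close>

lemma order_separation:
  fixes q :: "nat \<Rightarrow> complex"
  assumes lim: "(\<lambda>N. (of_real (1 / real N) * c1 + of_real ((1 / real N)\<^sup>2) * q N) /\<^sub>R (1 / real N)\<^sup>2) \<longlonglongrightarrow> 0"
    and q: "q \<longlonglongrightarrow> c2"
  shows "c1 = 0" and "c2 = 0"
proof -
  define f where "f N = (of_real (1 / real N) * c1 + of_real ((1 / real N)\<^sup>2) * q N) /\<^sub>R (1 / real N)\<^sup>2" for N
  have f: "f N = of_nat N * c1 + q N" if "N > 0" for N
    using that by (simp add: f_def scaleR_conv_of_real field_simps power2_eq_square)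
  have "(\<lambda>N. of_real (1 / real N) :: complex) \<longlonglongrightarrow> of_real 0"
    by (intro tendsto_of_real lim_1_over_n)
  then have inv0: "(\<lambda>N. of_real (1 / real N) :: complex) \<longlonglongrightarrow> 0" by simp
  have "f \<longlonglongrightarrow> 0" using lim by (simp add: f_def[abs_def])
  then have "(\<lambda>N. of_real (1 / real N) * (f N - q N)) \<longlonglongrightarrow> 0"
    using tendsto_mult[OF inv0 tendsto_diff[OF _ q, of f 0]] by simp
  moreover have "\<forall>\<^sub>F N in sequentially. of_real (1 / real N) * (f N - q N) = c1"
    using eventually_gt_at_top[of 0] by eventually_elim (simp add: f)
  ultimately have "(\<lambda>N. c1) \<longlonglongrightarrow> (0 :: complex)" by (rule Lim_transform_eventually)
  then show c1: "c1 = 0" by (simp add: LIMSEQ_const_iff)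
  have "\<forall>\<^sub>F N in sequentially. f N = q N"
    using eventually_gt_at_top[of 0] by eventually_elim (simp add: f c1)
  then have "q \<longlonglongrightarrow> 0" using \<open>f \<longlonglongrightarrow> 0\<close> Lim_transform_eventually by blast
  then show "c2 = 0" using q LIMSEQ_unique by blast
qed

section \<open>The residual of the ansatz at a fixed slow point\<close>

text \<open>Freezes one point of the slow coordinates, so that every limit is in
  \<open>\<epsilon>\<close> alone; the final proof interprets the locale at each point.
  \<open>D\<close> is the joint derivative because both slow times move together in time, while
  \<open>A'\<close> is given on the whole slice in \<open>x1\<close> so that it can be
  differentiated again. The eigenvalue equation enters only through its pairing with
  \<open>v1\<close>.\<close>

locale amplitude_expansion =
  fixes R :: nat
    and M :: "int \<Rightarrow> real \<Rightarrow> real^'n^'n" and K :: "int \<Rightarrow> real^'n^'n"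
    and off :: "'s::finite \<Rightarrow> int" and h :: "real^'n^'s \<Rightarrow> real \<Rightarrow> real^'n"
    and \<phi>0 \<omega>0 r :: real and v0 v1 v2 h1 h2 :: "complex^'n"
    and A :: "real \<Rightarrow> real \<Rightarrow> real \<Rightarrow> complex" and T1 x1 T2 :: real
    and D :: "real \<times> real \<times> real \<Rightarrow> complex" and A' :: "real \<Rightarrow> complex" and A2 :: complex
  assumes M_expansion: "\<And>m. \<bar>m\<bar> \<le> int R \<Longrightarrow>
        (\<lambda>p. norm (M m p - M m 0 - p *\<^sub>R K m)) \<in> O[at 0](\<lambda>p. p\<^sup>2)"
    and h_zero: "h 0 0 = 0"
    and h_cont: "\<And>p. continuous_on UNIV (\<lambda>y. h y p)"
    and h_third_order: "third_order h"
    and h_cubic: "cubic_coefficients h off v0 \<phi>0 h1 h2"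
    and left_eigenvector: "cinner (symbol R (\<lambda>m. M m 0) \<phi>0 *v v0) v1 = \<i> * of_real \<omega>0"
    and normalized: "cinner v0 v1 = 1"
    and A_deriv: "((\<lambda>(T1, x1, T2). A T1 x1 T2) has_derivative D) (at (T1, x1, T2))"
    and A'_deriv: "\<And>x. ((\<lambda>x. A T1 x T2) has_vector_derivative A' x) (at x)"
    and A2_deriv: "(A' has_vector_derivative A2) (at x1)"
begin

abbreviation "a0 \<equiv> A T1 x1 T2"

definition neighbour :: "real \<Rightarrow> int \<Rightarrow> complex" where
  "neighbour \<epsilon> m = A T1 (x1 + \<epsilon> * of_int m) T2"

text \<open>The slow part of the time derivative: the values of \<open>D\<close> on the unit vectors
  are the partial derivatives in \<open>T1\<close> and \<open>T2\<close>.\<close>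

definition drift :: "real \<Rightarrow> complex" where
  "drift \<epsilon> = \<epsilon> *\<^sub>R D (1, 0, 0) + \<epsilon>\<^sup>2 *\<^sub>R D (0, 0, 1)"

definition first_harmonic :: "real \<Rightarrow> complex^'n" where
  "first_harmonic \<epsilon> = (\<i> * of_real \<omega>0 * a0 + drift \<epsilon>) *s v0
     - (\<Sum>m\<in>{- int R..int R}. (cis (of_int m * \<phi>0) * neighbour \<epsilon> m) *s (cmat (M m (\<epsilon>\<^sup>2 * r)) *v v0))
     - (of_real (\<epsilon>\<^sup>2) * (a0 * of_real (norm a0 ^ 2))) *s h1"

text \<open>A factor \<open>\<epsilon>\<^sup>2\<close> is taken out, since the ansatz carries
  \<open>\<epsilon> ^ 3\<close> in this harmonic and the residual is divided by
  \<open>\<epsilon>\<close>.\<close>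

definition third_harmonic :: "real \<Rightarrow> complex^'n" where
  "third_harmonic \<epsilon> = (3 * \<i> * of_real \<omega>0 * a0 ^ 3 + 3 * a0\<^sup>2 * drift \<epsilon>) *s v2
     - (\<Sum>m\<in>{- int R..int R}. (cis (of_int m * (3 * \<phi>0)) * neighbour \<epsilon> m ^ 3) *s (cmat (M m (\<epsilon>\<^sup>2 * r)) *v v2))
     - (a0 ^ 3) *s h2"

definition stencil_state :: "real \<Rightarrow> real \<Rightarrow> real^'n^'s" where
  "stencil_state \<epsilon> \<theta> = (\<chi> s. ansatz_lattice \<omega>0 \<phi>0 v0 v2 A \<epsilon> \<theta> T1 x1 T2 0 (off s))"

text \<open>The reference value uses the central amplitude \<open>a0\<close> at all sites and omits
  the \<open>v2\<close> term; both simplifications turn out to cost only o(\<epsilon>^2) after the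
  division.\<close>

definition cubic_remainder :: "real \<Rightarrow> real \<Rightarrow> real^'n" where
  "cubic_remainder \<epsilon> \<theta> = (let \<alpha> = of_real \<epsilon> * cis \<theta> * a0 in
     (h (stencil_state \<epsilon> \<theta>) (\<epsilon>\<^sup>2 * r)
       - plus_cc ((\<alpha> * of_real (norm \<alpha> ^ 2)) *s h1 + (\<alpha> ^ 3) *s h2)) /\<^sub>R \<epsilon>)"

abbreviation "res \<equiv> \<lambda>\<epsilon> \<theta>. residual R M h off \<omega>0 \<phi>0 v0 v2 r A \<epsilon> \<theta> T1 x1 T2"

lemma lattice_state:
  "ansatz_lattice \<omega>0 \<phi>0 v0 v2 A \<epsilon> \<theta> T1 x1 T2 0 m
   = plus_cc ((of_real \<epsilon> * cis (\<theta> + \<phi>0 * of_int m) * neighbour \<epsilon> m) *s v0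
       + (of_real (\<epsilon> ^ 3) * cis (3 * (\<theta> + \<phi>0 * of_int m)) * neighbour \<epsilon> m ^ 3) *s v2)"
  by (simp add: ansatz_lattice_def ansatz_def neighbour_def)

lemma amplitude_time_derivative:
  "((\<lambda>s. A (T1 + \<epsilon> * s) x1 (T2 + \<epsilon>\<^sup>2 * s)) has_vector_derivative drift \<epsilon>) (at 0)"
proof -
  have "((\<lambda>s. (T1 + \<epsilon> * s, x1, T2 + \<epsilon>\<^sup>2 * s)) has_derivative (\<lambda>s. (\<epsilon> * s, 0, \<epsilon>\<^sup>2 * s))) (at 0)"
    by (auto intro!: derivative_eq_intros)
  from has_derivative_compose[OF this, of "\<lambda>(T1, x1, T2). A T1 x1 T2" D] A_deriv
  have "((\<lambda>s. A (T1 + \<epsilon> * s) x1 (T2 + \<epsilon>\<^sup>2 * s)) has_derivative (\<lambda>s. D (\<epsilon> * s, 0, \<epsilon>\<^sup>2 * s))) (at 0)"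
    by simp
  moreover have "D (\<epsilon> * s, 0, \<epsilon>\<^sup>2 * s) = s *\<^sub>R drift \<epsilon>" for s
  proof -
    have "linear D" using A_deriv has_derivative_linear by blast
    have "D (\<epsilon> * s, 0, \<epsilon>\<^sup>2 * s) = D ((s * \<epsilon>) *\<^sub>R (1, 0, 0) + (s * \<epsilon>\<^sup>2) *\<^sub>R (0, 0, 1))"
      by (simp add: mult.commute)
    also have "\<dots> = (s * \<epsilon>) *\<^sub>R D (1, 0, 0) + (s * \<epsilon>\<^sup>2) *\<^sub>R D (0, 0, 1)"
      by (simp only: linear_add[OF \<open>linear D\<close>] linear_cmul[OF \<open>linear D\<close>])
    finally show ?thesis by (simp add: drift_def scaleR_add_right)
  qed
  ultimately show ?thesis by (simp add: has_vector_derivative_def)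
qed

lemma ansatz_time_derivative:
  "vector_derivative (\<lambda>s. ansatz_lattice \<omega>0 \<phi>0 v0 v2 A \<epsilon> \<theta> T1 x1 T2 s 0) (at 0)
   = \<epsilon> *\<^sub>R plus_cc (cis \<theta> *s ((\<i> * of_real \<omega>0 * a0 + drift \<epsilon>) *s v0)
      + cis (3 * \<theta>) *s ((of_real (\<epsilon>\<^sup>2) * (3 * \<i> * of_real \<omega>0 * a0 ^ 3 + 3 * a0\<^sup>2 * drift \<epsilon>)) *s v2))"
proof -
  define a where "a s = A (T1 + \<epsilon> * s) x1 (T2 + \<epsilon>\<^sup>2 * s)" for s
  have a: "(a has_vector_derivative drift \<epsilon>) (at 0)"
    using amplitude_time_derivative by (simp add: a_def[abs_def])
  have a3: "((\<lambda>s. a s ^ 3) has_vector_derivative 3 * a0\<^sup>2 * drift \<epsilon>) (at 0)"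
    using has_vector_derivative_mult[OF a has_vector_derivative_mult[OF a a]]
    by (simp add: a_def power3_eq_cube power2_eq_square algebra_simps)
  have c: "((\<lambda>s. cis (b * (\<theta> + \<omega>0 * s))) has_vector_derivative \<i> * of_real (b * \<omega>0) * cis (b * \<theta>)) (at 0)" for b
    by (auto intro!: derivative_eq_intros simp: has_vector_derivative_def scaleR_conv_of_real)
  have "((\<lambda>s. of_real \<epsilon> * (cis (1 * (\<theta> + \<omega>0 * s)) * a s)) has_vector_derivative
      of_real \<epsilon> * (cis \<theta> * (\<i> * of_real \<omega>0 * a0 + drift \<epsilon>))) (at 0)"
    using has_vector_derivative_mult_right[OF has_vector_derivative_mult[OF c[of 1] a], of "of_real \<epsilon>"]
    by (simp add: a_def algebra_simps)
  note 1 = bounded_linear.has_vector_derivative[OF bounded_linear_scale_vector[of v0] this]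
  have "((\<lambda>s. of_real (\<epsilon> ^ 3) * (cis (3 * (\<theta> + \<omega>0 * s)) * a s ^ 3)) has_vector_derivative
      of_real (\<epsilon> ^ 3) * (cis (3 * \<theta>) * (3 * \<i> * of_real \<omega>0 * a0 ^ 3 + 3 * a0\<^sup>2 * drift \<epsilon>))) (at 0)"
    using has_vector_derivative_mult_right[OF has_vector_derivative_mult[OF c[of 3] a3], of "of_real (\<epsilon> ^ 3)"]
    by (simp add: a_def algebra_simps)
  note 2 = bounded_linear.has_vector_derivative[OF bounded_linear_scale_vector[of v2] this]
  have "(\<lambda>s. ansatz_lattice \<omega>0 \<phi>0 v0 v2 A \<epsilon> \<theta> T1 x1 T2 s 0)
      = (\<lambda>s. plus_cc ((of_real \<epsilon> * (cis (1 * (\<theta> + \<omega>0 * s)) * a s)) *s v0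
          + (of_real (\<epsilon> ^ 3) * (cis (3 * (\<theta> + \<omega>0 * s)) * a s ^ 3)) *s v2))"
    by (simp add: ansatz_lattice_def ansatz_def a_def mult.assoc)
  then have "vector_derivative (\<lambda>s. ansatz_lattice \<omega>0 \<phi>0 v0 v2 A \<epsilon> \<theta> T1 x1 T2 s 0) (at 0)
      = plus_cc ((of_real \<epsilon> * (cis \<theta> * (\<i> * of_real \<omega>0 * a0 + drift \<epsilon>))) *s v0
        + (of_real (\<epsilon> ^ 3) * (cis (3 * \<theta>) * (3 * \<i> * of_real \<omega>0 * a0 ^ 3 + 3 * a0\<^sup>2 * drift \<epsilon>))) *s v2)"
    using bounded_linear.has_vector_derivative[OF bounded_linear_plus_cc has_vector_derivative_add[OF 1 2]]
    by (simp add: vector_derivative_at)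
  also have "\<dots> = plus_cc (of_real \<epsilon> *s (cis \<theta> *s ((\<i> * of_real \<omega>0 * a0 + drift \<epsilon>) *s v0)
      + cis (3 * \<theta>) *s ((of_real (\<epsilon>\<^sup>2) * (3 * \<i> * of_real \<omega>0 * a0 ^ 3 + 3 * a0\<^sup>2 * drift \<epsilon>)) *s v2)))"
    by (rule arg_cong[where f=plus_cc])
       (simp add: vec_eq_iff power2_eq_square power3_eq_cube algebra_simps)
  finally show ?thesis by (simp only: plus_cc_scale)
qed

text \<open>A shift by \<open>m\<close> sites multiplies the first harmonic by a phase factor and
  the third by its cube, which is how the symbol at \<open>3 * \<phi>0\<close> arises.\<close>

lemma linear_coupling:
  "(\<Sum>m\<in>{- int R..int R}. M m p *v ansatz_lattice \<omega>0 \<phi>0 v0 v2 A \<epsilon> \<theta> T1 x1 T2 0 m)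
   = \<epsilon> *\<^sub>R plus_cc
      (cis \<theta> *s (\<Sum>m\<in>{- int R..int R}. (cis (of_int m * \<phi>0) * neighbour \<epsilon> m) *s (cmat (M m p) *v v0))
       + cis (3 * \<theta>) *s (of_real (\<epsilon>\<^sup>2) *s
          (\<Sum>m\<in>{- int R..int R}. (cis (of_int m * (3 * \<phi>0)) * neighbour \<epsilon> m ^ 3) *s (cmat (M m p) *v v2))))"
proof -
  have "M m p *v ansatz_lattice \<omega>0 \<phi>0 v0 v2 A \<epsilon> \<theta> T1 x1 T2 0 m
     = plus_cc (of_real \<epsilon> *s (cis \<theta> *s ((cis (of_int m * \<phi>0) * neighbour \<epsilon> m) *s (cmat (M m p) *v v0))
       + cis (3 * \<theta>) *s (of_real (\<epsilon>\<^sup>2) *s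
          ((cis (of_int m * (3 * \<phi>0)) * neighbour \<epsilon> m ^ 3) *s (cmat (M m p) *v v2)))))" for m
  proof -
    have c: "cis (\<theta> + \<phi>0 * of_int m) = cis \<theta> * cis (of_int m * \<phi>0)"
      "cis (3 * (\<theta> + \<phi>0 * of_int m)) = cis (3 * \<theta>) * cis (of_int m * (3 * \<phi>0))"
      by (simp_all add: cis_mult algebra_simps)
    show ?thesis
      unfolding lattice_state matrix_mult_plus_cc c
      by (rule arg_cong[where f=plus_cc])
         (simp add: vec_eq_iff matrix_vector_right_distrib vector_scalar_commute
           power2_eq_square power3_eq_cube algebra_simps)
  qed
  then show ?thesis
    by (simp only: linear_sum[OF bounded_linear.linear[OF bounded_linear_plus_cc], symmetric]
        plus_cc_scale[symmetric] vec.scale_sum_right vec.scale_right_distrib sum.distrib)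
qed

text \<open>For \<open>\<alpha> = of_real \<epsilon> * cis \<theta> * a0\<close> the two cubic
  monomials are multiples of \<open>cis \<theta>\<close> and \<open>cis (3 * \<theta>)\<close>. The
  cubic part thus adds only to harmonics already present, and the rest of \<open>h\<close> is the
  remainder.\<close>

lemma residual_eq:
  assumes "\<epsilon> > 0"
  shows "res \<epsilon> \<theta> = plus_cc (cis \<theta> *s first_harmonic \<epsilon> + cis (3 * \<theta>) *s (of_real (\<epsilon>\<^sup>2) *s third_harmonic \<epsilon>))
      - cubic_remainder \<epsilon> \<theta>"
proof -
  define \<alpha> where "\<alpha> = of_real \<epsilon> * cis \<theta> * a0"
  define N where "N = plus_cc (cis \<theta> *s ((of_real (\<epsilon>\<^sup>2) * (a0 * of_real (norm a0 ^ 2))) *s h1)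
        + cis (3 * \<theta>) *s (of_real (\<epsilon>\<^sup>2) *s (a0 ^ 3 *s h2)))"
  have "norm \<alpha> = \<epsilon> * norm a0" using assms by (simp add: \<alpha>_def norm_mult)
  moreover have "\<alpha> ^ 3 = of_real \<epsilon> * of_real (\<epsilon>\<^sup>2) * (cis (3 * \<theta>) * a0 ^ 3)"
  proof -
    have "cis (3 * \<theta>) = cis \<theta> ^ 3" by (simp add: Complex.DeMoivre)
    then show ?thesis by (simp add: \<alpha>_def power2_eq_square power3_eq_cube)
  qed
  ultimately have "plus_cc ((\<alpha> * of_real (norm \<alpha> ^ 2)) *s h1 + (\<alpha> ^ 3) *s h2)
      = plus_cc (of_real \<epsilon> *s (cis \<theta> *s ((of_real (\<epsilon>\<^sup>2) * (a0 * of_real (norm a0 ^ 2))) *s h1)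
        + cis (3 * \<theta>) *s (of_real (\<epsilon>\<^sup>2) *s (a0 ^ 3 *s h2))))"
    by (intro arg_cong[where f=plus_cc])
       (simp add: \<alpha>_def vec_eq_iff power_mult_distrib algebra_simps)
  then have "plus_cc ((\<alpha> * of_real (norm \<alpha> ^ 2)) *s h1 + (\<alpha> ^ 3) *s h2) = \<epsilon> *\<^sub>R N"
    by (simp only: plus_cc_scale N_def)
  then have rem: "h (stencil_state \<epsilon> \<theta>) (\<epsilon>\<^sup>2 * r) = \<epsilon> *\<^sub>R (cubic_remainder \<epsilon> \<theta> + N)"
    using assms by (simp add: cubic_remainder_def \<alpha>_def Let_def scaleR_add_right)
  have "res \<epsilon> \<theta> = plus_cc (cis \<theta> *s ((\<i> * of_real \<omega>0 * a0 + drift \<epsilon>) *s v0)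
      + cis (3 * \<theta>) *s ((of_real (\<epsilon>\<^sup>2) * (3 * \<i> * of_real \<omega>0 * a0 ^ 3 + 3 * a0\<^sup>2 * drift \<epsilon>)) *s v2))
    - plus_cc
      (cis \<theta> *s (\<Sum>m\<in>{- int R..int R}. (cis (of_int m * \<phi>0) * neighbour \<epsilon> m) *s (cmat (M m (\<epsilon>\<^sup>2 * r)) *v v0))
       + cis (3 * \<theta>) *s (of_real (\<epsilon>\<^sup>2) *s
          (\<Sum>m\<in>{- int R..int R}. (cis (of_int m * (3 * \<phi>0)) * neighbour \<epsilon> m ^ 3) *s (cmat (M m (\<epsilon>\<^sup>2 * r)) *v v2))))
    - (cubic_remainder \<epsilon> \<theta> + N)"
    using assms unfolding residual_def Let_def network_rhs_def ansatz_time_derivative linear_coupling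
      stencil_state_def[symmetric] rem
    by (simp only: scaleR_diff_right[symmetric] scaleR_add_right[symmetric]) simp
  also have "\<dots> = plus_cc (cis \<theta> *s first_harmonic \<epsilon> + cis (3 * \<theta>) *s (of_real (\<epsilon>\<^sup>2) *s third_harmonic \<epsilon>))
      - cubic_remainder \<epsilon> \<theta>"
  proof -
    have cc: "plus_cc X - plus_cc Y - (E + plus_cc Z) = plus_cc (X - Y - Z) - E" for X Y Z and E :: "real^'n"
      by (simp add: linear_diff[OF bounded_linear.linear[OF bounded_linear_plus_cc]])
    have split: "c *s P + c' *s ((e * b) *s v2) - (c *s S + c' *s (e *s S')) - (c *s Q + c' *s (e *s Q'))
        = c *s (P - S - Q) + c' *s (e *s (b *s v2 - S' - Q'))"
      for P S S' Q Q' :: "complex^'n" and c c' e b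
      by (simp add: vec_eq_iff algebra_simps)
    show ?thesis
      unfolding N_def cc split first_harmonic_def third_harmonic_def ..
  qed
  finally show ?thesis .
qed

section \<open>Limits of the explicit harmonics\<close>

lemma neighbour_tendsto: "((\<lambda>\<epsilon>. neighbour \<epsilon> m) \<longlongrightarrow> a0) (at_right 0)"
proof -
  have "isCont (\<lambda>x. A T1 x T2) x1" using A'_deriv has_vector_derivative_continuous by blast
  then show ?thesis unfolding neighbour_def
    by (rule isCont_tendsto_compose) (auto intro!: tendsto_eq_intros)
qed

lemma drift_tendsto: "(drift \<longlongrightarrow> 0) (at_right 0)"
  unfolding drift_def[abs_def] by (auto intro!: tendsto_eq_intros)

text \<open>The chain rule for the shift by \<open>\<epsilon> * of_int m\<close> yields the weights
  \<open>m\<close> and \<open>m\<close> squared, from which \<open>L1\<close> and \<open>L2\<close>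
  originate.\<close>

lemma neighbour_expansion:
  "((\<lambda>\<epsilon>. (neighbour \<epsilon> m - a0 - \<epsilon> *\<^sub>R (of_int m * A' x1)) /\<^sub>R \<epsilon>\<^sup>2) \<longlongrightarrow> (of_int m)\<^sup>2 * A2 / 2) (at_right 0)"
proof -
  have 1: "((\<lambda>\<epsilon>. neighbour \<epsilon> m) has_vector_derivative (of_int m * A' (x1 + y * of_int m))) (at y)" for y
  proof -
    have "((\<lambda>\<epsilon>. x1 + \<epsilon> * of_int m) has_vector_derivative of_int m) (at y)"
      by (auto intro!: derivative_eq_intros simp: has_vector_derivative_def)
    from vector_diff_chain_at[OF this A'_deriv]
    show ?thesis by (simp add: neighbour_def[abs_def] o_def scaleR_conv_of_real)
  qed
  have 2: "((\<lambda>y. of_int m * A' (x1 + y * of_int m)) has_vector_derivative (of_int m)\<^sup>2 * A2) (at 0)"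
  proof -
    have "((\<lambda>\<epsilon>. x1 + \<epsilon> * of_int m) has_vector_derivative of_int m) (at 0)"
      by (auto intro!: derivative_eq_intros simp: has_vector_derivative_def)
    from vector_diff_chain_at[OF this, of A' A2] A2_deriv
    have "((\<lambda>y. A' (x1 + y * of_int m)) has_vector_derivative of_int m * A2) (at 0)"
      by (simp add: o_def scaleR_conv_of_real)
    from has_vector_derivative_mult_right[OF this, of "of_int m"]
    show ?thesis by (simp add: power2_eq_square mult.assoc)
  qed
  have "neighbour 0 m = a0" by (simp add: neighbour_def)
  then show ?thesis
    using tendsto_within_subset[OF second_order_taylor[OF 1 2] subset_UNIV, of "{0<..}"]
    by (simp add: scaleR_conv_of_real)
qed

lemma cmat_tendsto:
  assumes "m \<in> {- int R..int R}"
  shows "((\<lambda>\<epsilon>. cmat (M m (\<epsilon>\<^sup>2 * r)) *v w) \<longlongrightarrow> cmat (M m 0) *v w) (at_right 0)"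
proof -
  have "((\<lambda>\<epsilon>. \<epsilon>\<^sup>2 *\<^sub>R ((cmat (M m (\<epsilon>\<^sup>2 * r)) *v w - cmat (M m 0) *v w) /\<^sub>R \<epsilon>\<^sup>2) + cmat (M m 0) *v w)
      \<longlongrightarrow> 0\<^sup>2 *\<^sub>R (cmat (r *\<^sub>R K m) *v w) + cmat (M m 0) *v w) (at_right 0)"
    using assms by (intro tendsto_intros cmat_quotient_tendsto M_expansion) auto
  moreover have "\<forall>\<^sub>F \<epsilon> in at_right 0. \<epsilon>\<^sup>2 *\<^sub>R ((cmat (M m (\<epsilon>\<^sup>2 * r)) *v w - cmat (M m 0) *v w) /\<^sub>R \<epsilon>\<^sup>2) + cmat (M m 0) *v w
       = cmat (M m (\<epsilon>\<^sup>2 * r)) *v w"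
    using eventually_at_right_less[of "0::real"] by eventually_elim simp
  ultimately show ?thesis by (auto dest: Lim_transform_eventually)
qed

text \<open>At leading order all neighbours have amplitude \<open>a0\<close> and the drift
  disappears, so the cube of \<open>a0\<close> can be pulled out of every term.\<close>

lemma third_harmonic_tendsto:
  "(third_harmonic \<longlongrightarrow> a0 ^ 3 *s ((mat (3 * \<i> * of_real \<omega>0) - symbol R (\<lambda>m. M m 0) (3 * \<phi>0)) *v v2 - h2))
     (at_right 0)"
proof -
  have "(third_harmonic \<longlongrightarrow> (3 * \<i> * of_real \<omega>0 * a0 ^ 3 + 3 * a0\<^sup>2 * 0) *s v2
     - (\<Sum>m\<in>{- int R..int R}. (cis (of_int m * (3 * \<phi>0)) * a0 ^ 3) *s (cmat (M m 0) *v v2))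
     - (a0 ^ 3) *s h2) (at_right 0)"
    unfolding third_harmonic_def[abs_def]
    by (intro tendsto_intros cmat_tendsto neighbour_tendsto drift_tendsto) auto
  then show ?thesis
  proof (rule tendsto_eq_rhs)
    have "(\<Sum>m\<in>{- int R..int R}. (cis (of_int m * (3 * \<phi>0)) * a0 ^ 3) *s (cmat (M m 0) *v v2))
        = a0 ^ 3 *s (symbol R (\<lambda>m. M m 0) (3 * \<phi>0) *v v2)"
      by (simp add: symbol_mult_vector vec.scale_sum_right mult.commute)
    then show "(3 * \<i> * of_real \<omega>0 * a0 ^ 3 + 3 * a0\<^sup>2 * 0) *s v2
     - (\<Sum>m\<in>{- int R..int R}. (cis (of_int m * (3 * \<phi>0)) * a0 ^ 3) *s (cmat (M m 0) *v v2))
     - (a0 ^ 3) *s h2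
     = a0 ^ 3 *s ((mat (3 * \<i> * of_real \<omega>0) - symbol R (\<lambda>m. M m 0) (3 * \<phi>0)) *v v2 - h2)"
      by (simp add: matrix_vector_mult_diff_rdistrib mat_mult_vector vec.scale_right_diff_distrib mult.commute)
  qed
qed

text \<open>The exact remainder after orders 0 and 1 are removed, divided by
  \<open>\<epsilon>\<^sup>2\<close>. The product of amplitude and coupling is split so that each
  summand has a limit: Taylor remainder times perturbed coupling, plus linearised amplitude times
  increment of the coupling.\<close>

definition second_order_term :: "real \<Rightarrow> complex" where
  "second_order_term \<epsilon> = D (0, 0, 1) - a0 * of_real (norm a0 ^ 2) * cinner h1 v1
     - (\<Sum>m\<in>{- int R..int R}. cis (of_int m * \<phi>0) *
         ((neighbour \<epsilon> m - a0 - \<epsilon> *\<^sub>R (of_int m * A' x1)) /\<^sub>R \<epsilon>\<^sup>2 * cinner (cmat (M m (\<epsilon>\<^sup>2 * r)) *v v0) v1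
          + (a0 + \<epsilon> *\<^sub>R (of_int m * A' x1))
            * cinner ((cmat (M m (\<epsilon>\<^sup>2 * r)) *v v0 - cmat (M m 0) *v v0) /\<^sub>R \<epsilon>\<^sup>2) v1))"

lemma second_order_term_tendsto:
  "(second_order_term \<longlongrightarrow> D (0, 0, 1) - (of_real r * cinner (symbol R K \<phi>0 *v v0) v1 * a0
      + cinner (symbol R (\<lambda>m. (real_of_int m)\<^sup>2 *\<^sub>R M m 0) \<phi>0 *v v0) v1 / 2 * A2
      + cinner h1 v1 * a0 * of_real (norm a0 ^ 2))) (at_right 0)"
proof -
  have "(second_order_term \<longlongrightarrow> D (0, 0, 1) - a0 * of_real (norm a0 ^ 2) * cinner h1 v1
     - (\<Sum>m\<in>{- int R..int R}. cis (of_int m * \<phi>0) *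
         ((of_int m)\<^sup>2 * A2 / 2 * cinner (cmat (M m 0) *v v0) v1
          + (a0 + 0 *\<^sub>R (of_int m * A' x1)) * cinner (cmat (r *\<^sub>R K m) *v v0) v1))) (at_right 0)"
    unfolding second_order_term_def[abs_def]
    by (intro tendsto_intros neighbour_expansion cmat_tendsto cmat_quotient_tendsto M_expansion) auto
  then show ?thesis
    by (rule tendsto_eq_rhs)
       (simp add: symbol_mult_vector cinner_sum_left cinner_scale_left cmat_scaleR
         sum.distrib sum_distrib_left sum_distrib_right sum_divide_distrib algebra_simps)
qed

lemma first_harmonic_expansion:
  assumes "\<epsilon> > 0"
  shows "cinner (first_harmonic \<epsilon>) v1
    = of_real \<epsilon> * (D (1, 0, 0) - cinner (symbol R (\<lambda>m. real_of_int m *\<^sub>R M m 0) \<phi>0 *v v0) v1 * A' x1)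
      + of_real (\<epsilon>\<^sup>2) * second_order_term \<epsilon>"
proof -
  define Z where "Z = {- int R..int R}"
  define e where "e m = cis (of_int m * \<phi>0)" for m
  define G where "G m = cinner (cmat (M m (\<epsilon>\<^sup>2 * r)) *v v0) v1" for m
  define G0 where "G0 m = cinner (cmat (M m 0) *v v0) v1" for m
  define Q where "Q m = (neighbour \<epsilon> m - a0 - \<epsilon> *\<^sub>R (of_int m * A' x1)) /\<^sub>R \<epsilon>\<^sup>2 * G m
          + (a0 + \<epsilon> *\<^sub>R (of_int m * A' x1)) * ((G m - G0 m) /\<^sub>R \<epsilon>\<^sup>2)" for m
  have scaleR_cinner: "cinner (x /\<^sub>R \<epsilon>\<^sup>2) v1 = cinner x v1 /\<^sub>R \<epsilon>\<^sup>2" for x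
    by (simp add: cinner_def scaleR_sum_right)
  have second: "second_order_term \<epsilon>
      = D (0, 0, 1) - a0 * of_real (norm a0 ^ 2) * cinner h1 v1 - (\<Sum>m\<in>Z. e m * Q m)"
    by (simp add: second_order_term_def Q_def G_def G0_def e_def Z_def scaleR_cinner cinner_diff_left)
  \<comment> \<open>The mixed split in \<open>Q\<close> makes this an identity for every positive
    \<open>\<epsilon>\<close>, without discarded terms.\<close>
  have Q: "neighbour \<epsilon> m * G m = a0 * G0 m + of_real \<epsilon> * (of_int m * A' x1 * G0 m) + of_real (\<epsilon>\<^sup>2) * Q m" for m
    using assms by (simp add: Q_def scaleR_conv_of_real field_simps)
  \<comment> \<open>This is the term that cancels the fast rotation
    \<open>\<i> * of_real \<omega>0 * a0\<close> coming from the time derivative.\<close>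
  have zeroth: "(\<Sum>m\<in>Z. e m * G0 m) = \<i> * of_real \<omega>0"
    using left_eigenvector
    by (simp add: symbol_mult_vector cinner_sum_left cinner_scale_left G0_def e_def Z_def)
  have first: "(\<Sum>m\<in>Z. e m * (of_int m * G0 m)) = cinner (symbol R (\<lambda>m. real_of_int m *\<^sub>R M m 0) \<phi>0 *v v0) v1"
    by (simp add: symbol_mult_vector cinner_sum_left cinner_scale_left cmat_scaleR G0_def e_def Z_def mult.assoc)
  have "(\<Sum>m\<in>Z. e m * neighbour \<epsilon> m * G m)
      = (\<Sum>m\<in>Z. e m * G0 m) * a0 + of_real \<epsilon> * ((\<Sum>m\<in>Z. e m * (of_int m * G0 m)) * A' x1)
        + of_real (\<epsilon>\<^sup>2) * (\<Sum>m\<in>Z. e m * Q m)"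
    by (simp add: mult.assoc Q sum.distrib sum_distrib_left sum_distrib_right distrib_left mult.left_commute)
       (simp add: algebra_simps)
  then have "(\<Sum>m\<in>Z. e m * neighbour \<epsilon> m * G m) = \<i> * of_real \<omega>0 * a0
      + of_real \<epsilon> * (cinner (symbol R (\<lambda>m. real_of_int m *\<^sub>R M m 0) \<phi>0 *v v0) v1 * A' x1)
      + of_real (\<epsilon>\<^sup>2) * (\<Sum>m\<in>Z. e m * Q m)"
    unfolding zeroth first .
  moreover have "cinner (first_harmonic \<epsilon>) v1 = \<i> * of_real \<omega>0 * a0 + drift \<epsilon>
      - (\<Sum>m\<in>Z. e m * neighbour \<epsilon> m * G m) - of_real (\<epsilon>\<^sup>2) * (a0 * of_real (norm a0 ^ 2)) * cinner h1 v1"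
    by (simp add: first_harmonic_def cinner_add_left vec.scale_left_distrib
        cinner_diff_left cinner_sum_left cinner_scale_left normalized
        G_def e_def Z_def)
  ultimately show ?thesis
    by (simp add: second drift_def scaleR_conv_of_real algebra_simps)
qed

section \<open>The cubic remainder is negligible\<close>

lemma continuous_stencil_state: "continuous_on S (stencil_state \<epsilon>)"
proof -
  have "continuous_on S (\<lambda>\<theta>. (of_real \<epsilon> * cis (\<theta> + \<phi>0 * of_int m) * neighbour \<epsilon> m) *s v0
       + (of_real (\<epsilon> ^ 3) * cis (3 * (\<theta> + \<phi>0 * of_int m)) * neighbour \<epsilon> m ^ 3) *s v2)" for m
    unfolding vector_scalar_mult_def by (intro continuous_intros)
  from bounded_linear.continuous_on[OF bounded_linear_plus_cc this]
  show ?thesis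
    unfolding stencil_state_def[abs_def] lattice_state by (intro continuous_intros)
qed

text \<open>Continuity in the phase gives the integrability needed to split off and to bound the
  harmonics of the remainder.\<close>

lemma continuous_cubic_remainder: "continuous_on S (cubic_remainder \<epsilon>)"
proof -
  have "continuous_on S (\<lambda>\<theta>. h (stencil_state \<epsilon> \<theta>) (\<epsilon>\<^sup>2 * r))"
    by (rule continuous_on_compose2[OF h_cont continuous_stencil_state]) auto
  moreover have "continuous_on S (\<lambda>\<theta>. plus_cc
      ((of_real \<epsilon> * cis \<theta> * a0 * of_real (norm (of_real \<epsilon> * cis \<theta> * a0) ^ 2)) *s h1
        + ((of_real \<epsilon> * cis \<theta> * a0) ^ 3) *s h2))"
    unfolding vector_scalar_mult_def
    by (intro bounded_linear.continuous_on[OF bounded_linear_plus_cc] continuous_intros)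
  ultimately show ?thesis
    unfolding cubic_remainder_def[abs_def] Let_def by (intro continuous_intros)
qed

text \<open>The phase enters only through factors of modulus 1 and drops out of the norms. The
  amplitude shifts tend to 0 and the \<open>v2\<close> term is smaller by
  \<open>\<epsilon>\<^sup>2\<close>, so the deviation is o(\<epsilon>) for all phases at
  once.\<close>

lemma stencil_state_close:
  assumes "\<delta> > 0"
  shows "\<forall>\<^sub>F \<epsilon> in at_right 0. \<forall>\<theta>. norm (stencil_state \<epsilon> \<theta>
     - (\<chi> s. plus_cc ((of_real \<epsilon> * cis \<theta> * a0 * cis (of_int (off s) * \<phi>0)) *s v0))) \<le> \<delta> * \<epsilon>"
proof -
  define \<eta> where "\<eta> \<epsilon> = (\<Sum>s\<in>UNIV. 2 * (norm (neighbour \<epsilon> (off s) - a0) * norm v0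
      + \<epsilon>\<^sup>2 * norm (neighbour \<epsilon> (off s)) ^ 3 * norm v2))" for \<epsilon>
  have "(\<eta> \<longlongrightarrow> (\<Sum>s\<in>(UNIV :: 's set). 2 * (norm (a0 - a0) * norm v0 + 0\<^sup>2 * norm a0 ^ 3 * norm v2))) (at_right 0)"
    unfolding \<eta>_def[abs_def] by (intro tendsto_intros neighbour_tendsto)
  then have "(\<eta> \<longlongrightarrow> 0) (at_right 0)" by simp
  then have "\<forall>\<^sub>F \<epsilon> in at_right 0. \<eta> \<epsilon> < \<delta>" using assms by (rule order_tendstoD(2))
  then show ?thesis
    using eventually_at_right_less
  proof eventually_elim
    case (elim \<epsilon>)
    show ?case
    proof
      fix \<theta>
      define Y where "Y = stencil_state \<epsilon> \<theta> - (\<chi> s. plus_cc ((of_real \<epsilon> * cis \<theta> * a0 * cis (of_int (off s) * \<phi>0)) *s v0))"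
      have "norm (Y $ s) \<le> \<epsilon> * (2 * (norm (neighbour \<epsilon> (off s) - a0) * norm v0
          + \<epsilon>\<^sup>2 * norm (neighbour \<epsilon> (off s)) ^ 3 * norm v2))" for s
      proof -
        have c: "cis (\<theta> + \<phi>0 * of_int (off s)) = cis \<theta> * cis (of_int (off s) * \<phi>0)"
          by (simp add: cis_mult mult.commute)
        have "Y $ s = plus_cc ((of_real \<epsilon> * cis (\<theta> + \<phi>0 * of_int (off s)) * (neighbour \<epsilon> (off s) - a0)) *s v0
            + (of_real (\<epsilon> ^ 3) * cis (3 * (\<theta> + \<phi>0 * of_int (off s))) * neighbour \<epsilon> (off s) ^ 3) *s v2)"
          unfolding Y_def c
          by (simp add: stencil_state_def lattice_state c
              linear_diff[OF bounded_linear.linear[OF bounded_linear_plus_cc], symmetric])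
             (simp add: algebra_simps vec.scale_left_diff_distrib)
        then have "norm (Y $ s) \<le> 2 * (norm ((of_real \<epsilon> * cis (\<theta> + \<phi>0 * of_int (off s)) * (neighbour \<epsilon> (off s) - a0)) *s v0)
            + norm ((of_real (\<epsilon> ^ 3) * cis (3 * (\<theta> + \<phi>0 * of_int (off s))) * neighbour \<epsilon> (off s) ^ 3) *s v2))"
          using order_trans[OF norm_plus_cc_le mult_left_mono[OF norm_triangle_ineq]] by simp
        also have "\<dots> = \<epsilon> * (2 * (norm (neighbour \<epsilon> (off s) - a0) * norm v0
            + \<epsilon>\<^sup>2 * norm (neighbour \<epsilon> (off s)) ^ 3 * norm v2))"
          using elim by (simp add: norm_vector_scale norm_mult norm_power)
            (simp add: power2_eq_square power3_eq_cube algebra_simps)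
        finally show ?thesis .
      qed
      then have "(\<Sum>s\<in>UNIV. norm (Y $ s)) \<le> \<epsilon> * \<eta> \<epsilon>"
        unfolding \<eta>_def sum_distrib_left by (intro sum_mono)
      moreover have "norm Y \<le> (\<Sum>s\<in>UNIV. norm (Y $ s))"
        unfolding norm_vec_def by (rule L2_set_le_sum) simp
      moreover have "\<epsilon> * \<eta> \<epsilon> \<le> \<delta> * \<epsilon>" using elim by simp
      ultimately show "norm Y \<le> \<delta> * \<epsilon>" by linarith
    qed
  qed
qed

text \<open>The nonlinear estimate is applied with \<open>C = norm a0\<close>; division by
  \<open>\<epsilon>\<close> lowers its third power to the second.\<close>

lemma cubic_remainder_small:
  assumes "c > 0"
  shows "\<forall>\<^sub>F \<epsilon> in at_right 0. \<forall>\<theta>. norm (cubic_remainder \<epsilon> \<theta>) \<le> c * \<epsilon>\<^sup>2"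
proof -
  obtain \<delta> where "\<delta> > 0" and \<delta>: "\<And>\<epsilon> \<alpha> Y p. 0 < \<epsilon> \<Longrightarrow> \<epsilon> < \<delta> \<Longrightarrow> norm \<alpha> \<le> norm a0 * \<epsilon> \<Longrightarrow> \<bar>p\<bar> < \<delta> \<Longrightarrow>
       norm (Y - (\<chi> s. plus_cc ((\<alpha> * cis (of_int (off s) * \<phi>0)) *s v0))) \<le> \<delta> * \<epsilon> \<Longrightarrow>
       norm (h Y p - plus_cc ((\<alpha> * of_real (norm \<alpha> ^ 2)) *s h1 + (\<alpha> ^ 3) *s h2)) \<le> c * \<epsilon> ^ 3"
    by (rule cubic_nonlinearity_estimate[OF h_third_order h_zero h_cubic assms norm_ge_zero[of a0]]) blast
  have "((\<lambda>\<epsilon>. \<bar>\<epsilon>\<^sup>2 * r\<bar>) \<longlongrightarrow> 0) (at_right 0)" by (auto intro!: tendsto_eq_intros)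
  then have "\<forall>\<^sub>F \<epsilon> in at_right 0. \<bar>\<epsilon>\<^sup>2 * r\<bar> < \<delta>" using \<open>\<delta> > 0\<close> by (rule order_tendstoD(2))
  moreover have "\<forall>\<^sub>F \<epsilon> in at_right 0. \<epsilon> < \<delta>"
    using \<open>\<delta> > 0\<close> by (rule order_tendstoD(2)[OF tendsto_ident_at])
  ultimately show ?thesis
    using eventually_at_right_less stencil_state_close[OF \<open>\<delta> > 0\<close>]
  proof eventually_elim
    case (elim \<epsilon>)
    show ?case
    proof
      fix \<theta>
      define \<alpha> where "\<alpha> = of_real \<epsilon> * cis \<theta> * a0"
      have "norm \<alpha> \<le> norm a0 * \<epsilon>" using elim by (simp add: \<alpha>_def norm_mult)
      then have "norm (h (stencil_state \<epsilon> \<theta>) (\<epsilon>\<^sup>2 * r)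
          - plus_cc ((\<alpha> * of_real (norm \<alpha> ^ 2)) *s h1 + (\<alpha> ^ 3) *s h2)) \<le> c * \<epsilon> ^ 3"
        using elim by (intro \<delta>) (auto simp: \<alpha>_def)
      moreover have "norm (cubic_remainder \<epsilon> \<theta>) = norm (h (stencil_state \<epsilon> \<theta>) (\<epsilon>\<^sup>2 * r)
          - plus_cc ((\<alpha> * of_real (norm \<alpha> ^ 2)) *s h1 + (\<alpha> ^ 3) *s h2)) / \<epsilon>"
        using elim by (simp add: cubic_remainder_def Let_def \<alpha>_def divide_inverse_commute)
      ultimately show "norm (cubic_remainder \<epsilon> \<theta>) \<le> c * \<epsilon>\<^sup>2"
        using elim by (simp add: divide_le_eq power2_eq_square power3_eq_cube mult.assoc)
    qed
  qed
qed

lemma harmonic_remainder_tendsto: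
  "((\<lambda>\<epsilon>. harmonic k (cubic_remainder \<epsilon>) /\<^sub>R \<epsilon>\<^sup>2) \<longlongrightarrow> 0) (at_right 0)"
proof (rule tendstoI)
  fix e :: real assume "e > 0"
  define c where "c = e / (2 * CARD('n))"
  have "c > 0" using \<open>e > 0\<close> by (simp add: c_def)
  show "\<forall>\<^sub>F \<epsilon> in at_right 0. dist (harmonic k (cubic_remainder \<epsilon>) /\<^sub>R \<epsilon>\<^sup>2) 0 < e"
    using cubic_remainder_small[OF \<open>c > 0\<close>] eventually_at_right_less
  proof eventually_elim
    case (elim \<epsilon>)
    then have "norm (harmonic k (cubic_remainder \<epsilon>)) \<le> CARD('n) * (c * \<epsilon>\<^sup>2)"
      by (intro norm_harmonic_le continuous_cubic_remainder) auto
    also have "\<dots> = e / 2 * \<epsilon>\<^sup>2" by (simp add: c_def)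
    finally have "norm (harmonic k (cubic_remainder \<epsilon>)) / \<epsilon>\<^sup>2 \<le> e / 2"
      using elim by (simp add: divide_le_eq)
    moreover have "norm (harmonic k (cubic_remainder \<epsilon>) /\<^sub>R \<epsilon>\<^sup>2) = norm (harmonic k (cubic_remainder \<epsilon>)) / \<epsilon>\<^sup>2"
      by (simp add: divide_inverse_commute)
    ultimately show ?case using \<open>e > 0\<close> unfolding dist_norm diff_zero by linarith
  qed
qed

section \<open>Equations for the amplitude and for the third harmonic\<close>

lemma harmonic_residual:
  assumes "\<epsilon> > 0"
  shows "harmonic 1 (res \<epsilon>) = first_harmonic \<epsilon> - harmonic 1 (cubic_remainder \<epsilon>)"
    and "harmonic 3 (res \<epsilon>) = of_real (\<epsilon>\<^sup>2) *s third_harmonic \<epsilon> - harmonic 3 (cubic_remainder \<epsilon>)"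
proof -
  define f where "f \<theta> = plus_cc (cis \<theta> *s first_harmonic \<epsilon> + cis (3 * \<theta>) *s (of_real (\<epsilon>\<^sup>2) *s third_harmonic \<epsilon>))" for \<theta>
  have "continuous_on {0..2 * pi} f"
    unfolding f_def[abs_def] vector_scalar_mult_def
    by (intro bounded_linear.continuous_on[OF bounded_linear_plus_cc] continuous_intros)
  moreover have "res \<epsilon> = (\<lambda>\<theta>. f \<theta> - cubic_remainder \<epsilon> \<theta>)"
    by (rule ext) (simp only: residual_eq[OF assms] f_def)
  ultimately have "harmonic k (res \<epsilon>) = harmonic k f - harmonic k (cubic_remainder \<epsilon>)" for k
    using harmonic_diff[OF _ continuous_cubic_remainder] by simp
  then show "harmonic 1 (res \<epsilon>) = first_harmonic \<epsilon> - harmonic 1 (cubic_remainder \<epsilon>)"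
    and "harmonic 3 (res \<epsilon>) = of_real (\<epsilon>\<^sup>2) *s third_harmonic \<epsilon> - harmonic 3 (cubic_remainder \<epsilon>)"
    unfolding f_def by (simp_all only: harmonic_trigonometric)
qed

lemma inverse_nat_at_right: "filterlim (\<lambda>N. 1 / real N) (at_right 0) sequentially"
proof -
  have "\<forall>\<^sub>F N in sequentially. 1 / real N \<in> {0<..} \<and> 1 / real N \<noteq> 0"
    using eventually_gt_at_top[of 0] by eventually_elim simp
  then show ?thesis by (simp add: filterlim_at lim_1_over_n)
qed

text \<open>Adding the harmonic of the remainder, negligible at this order, to the one in the
  hypothesis leaves exactly the expansion of \<open>first_harmonic\<close>;
  \<open>order_separation\<close> then extracts both equations from one limit.\<close>

lemma amplitude_equations:
  assumes "(\<lambda>N. cinner (harmonic 1 (res (1 / real N))) v1) \<in> o(\<lambda>N. complex_of_real ((1 / real N)\<^sup>2))"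
  shows "D (1, 0, 0) = cinner (symbol R (\<lambda>m. real_of_int m *\<^sub>R M m 0) \<phi>0 *v v0) v1 * A' x1"
    and "D (0, 0, 1) = of_real r * cinner (symbol R K \<phi>0 *v v0) v1 * a0
      + cinner (symbol R (\<lambda>m. (real_of_int m)\<^sup>2 *\<^sub>R M m 0) \<phi>0 *v v0) v1 / 2 * A2
      + cinner h1 v1 * a0 * of_real (norm a0 ^ 2)"
proof -
  let ?c1 = "D (1, 0, 0) - cinner (symbol R (\<lambda>m. real_of_int m *\<^sub>R M m 0) \<phi>0 *v v0) v1 * A' x1"
  let ?e = "\<lambda>N. 1 / real N"
  have "(\<lambda>N. cinner (harmonic 1 (res (?e N))) v1 / of_real ((?e N)\<^sup>2)) \<longlonglongrightarrow> 0"
    using assms by (rule smalloD_tendsto)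
  moreover have "(\<lambda>N. cinner (harmonic 1 (cubic_remainder (?e N)) /\<^sub>R (?e N)\<^sup>2) v1) \<longlonglongrightarrow> cinner 0 v1"
    by (intro tendsto_intros filterlim_compose[OF harmonic_remainder_tendsto inverse_nat_at_right])
  ultimately have "(\<lambda>N. cinner (harmonic 1 (res (?e N))) v1 / of_real ((?e N)\<^sup>2)
      + cinner (harmonic 1 (cubic_remainder (?e N)) /\<^sub>R (?e N)\<^sup>2) v1) \<longlonglongrightarrow> 0 + cinner 0 v1"
    by (rule tendsto_add)
  then have sum0: "(\<lambda>N. cinner (harmonic 1 (res (?e N))) v1 / of_real ((?e N)\<^sup>2)
      + cinner (harmonic 1 (cubic_remainder (?e N)) /\<^sub>R (?e N)\<^sup>2) v1) \<longlonglongrightarrow> 0"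
    by (simp add: cinner_def)
  have "\<forall>\<^sub>F N in sequentially. cinner (harmonic 1 (res (?e N))) v1 / of_real ((?e N)\<^sup>2)
      + cinner (harmonic 1 (cubic_remainder (?e N)) /\<^sub>R (?e N)\<^sup>2) v1
    = (of_real (?e N) * ?c1 + of_real ((?e N)\<^sup>2) * second_order_term (?e N)) /\<^sub>R (?e N)\<^sup>2"
    using eventually_gt_at_top[of 0]
  proof eventually_elim
    case (elim N)
    then have e: "?e N > 0" by simp
    have scaleR_cinner: "cinner (x /\<^sub>R s) v1 = cinner x v1 /\<^sub>R s" for x s
      by (simp add: cinner_def scaleR_sum_right)
    have "cinner (harmonic 1 (res (?e N))) v1 / of_real ((?e N)\<^sup>2)
        + cinner (harmonic 1 (cubic_remainder (?e N)) /\<^sub>R (?e N)\<^sup>2) v1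
      = cinner (first_harmonic (?e N)) v1 /\<^sub>R (?e N)\<^sup>2"
      unfolding harmonic_residual(1)[OF e] scaleR_cinner cinner_diff_left
      by (simp add: scaleR_conv_of_real divide_inverse_commute right_diff_distrib)
    then show ?case unfolding first_harmonic_expansion[OF e] .
  qed
  with sum0 have lim: "(\<lambda>N. (of_real (?e N) * ?c1 + of_real ((?e N)\<^sup>2) * second_order_term (?e N)) /\<^sub>R (?e N)\<^sup>2) \<longlonglongrightarrow> 0"
    by (rule Lim_transform_eventually)
  note sep = order_separation[OF lim filterlim_compose[OF second_order_term_tendsto inverse_nat_at_right]]
  show "D (1, 0, 0) = cinner (symbol R (\<lambda>m. real_of_int m *\<^sub>R M m 0) \<phi>0 *v v0) v1 * A' x1"
    using sep(1) by simp
  show "D (0, 0, 1) = of_real r * cinner (symbol R K \<phi>0 *v v0) v1 * a0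
      + cinner (symbol R (\<lambda>m. (real_of_int m)\<^sup>2 *\<^sub>R M m 0) \<phi>0 *v v0) v1 / 2 * A2
      + cinner h1 v1 * a0 * of_real (norm a0 ^ 2)"
    using sep(2) by simp
qed

text \<open>The limit of the third harmonic is \<open>a0 ^ 3\<close> times the defect of the
  equation, so one point with nonzero amplitude decides it.\<close>

lemma third_harmonic_equation:
  assumes "(\<lambda>N. norm (harmonic 3 (res (1 / real N)))) \<in> o(\<lambda>N. (1 / real N)\<^sup>2)"
    and "a0 \<noteq> 0"
  shows "(mat (3 * \<i> * of_real \<omega>0) - symbol R (\<lambda>m. M m 0) (3 * \<phi>0)) *v v2 = h2"
proof -
  let ?e = "\<lambda>N. 1 / real N"
  have "(\<lambda>N. norm (harmonic 3 (res (?e N))) / (?e N)\<^sup>2) \<longlonglongrightarrow> 0"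
    using assms(1) by (rule smalloD_tendsto)
  then have "(\<lambda>N. norm (harmonic 3 (res (?e N)) /\<^sub>R (?e N)\<^sup>2)) \<longlonglongrightarrow> 0"
    by (simp add: divide_inverse_commute)
  then have "(\<lambda>N. harmonic 3 (res (?e N)) /\<^sub>R (?e N)\<^sup>2) \<longlonglongrightarrow> 0"
    by (rule tendsto_norm_zero_cancel)
  from tendsto_add[OF this filterlim_compose[OF harmonic_remainder_tendsto[of 3] inverse_nat_at_right]]
  have sum0: "(\<lambda>N. harmonic 3 (res (?e N)) /\<^sub>R (?e N)\<^sup>2
      + harmonic 3 (cubic_remainder (?e N)) /\<^sub>R (?e N)\<^sup>2) \<longlonglongrightarrow> 0" by simp
  have "\<forall>\<^sub>F N in sequentially. harmonic 3 (res (?e N)) /\<^sub>R (?e N)\<^sup>2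
      + harmonic 3 (cubic_remainder (?e N)) /\<^sub>R (?e N)\<^sup>2 = third_harmonic (?e N)"
    using eventually_gt_at_top[of 0]
  proof eventually_elim
    case (elim N)
    then have e: "?e N > 0" by simp
    have scale: "of_real c *s x = c *\<^sub>R x" for c and x :: "complex^'n"
      by (simp add: vec_eq_iff scaleR_conv_of_real[where 'a=complex])
    then show ?case
      unfolding harmonic_residual(2)[OF e] scale scaleR_add_right[symmetric] using e by simp
  qed
  with sum0 have "(\<lambda>N. third_harmonic (?e N)) \<longlonglongrightarrow> 0" by (rule Lim_transform_eventually)
  then have "a0 ^ 3 *s ((mat (3 * \<i> * of_real \<omega>0) - symbol R (\<lambda>m. M m 0) (3 * \<phi>0)) *v v2 - h2) = 0"
    using LIMSEQ_unique filterlim_compose[OF third_harmonic_tendsto inverse_nat_at_right] by blast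
  then show ?thesis using assms(2) by (simp add: vec_eq_iff)
qed

end

section \<open>Transport along characteristics and the equation in the comoving frame\<close>

theorem proposition2:
  fixes R :: nat
    and M :: "int \<Rightarrow> real \<Rightarrow> real^'n^'n" and K :: "int \<Rightarrow> real^'n^'n"
    and off :: "'s::finite \<Rightarrow> int" and h :: "real^'n^'s \<Rightarrow> real \<Rightarrow> real^'n"
    and lam :: "real \<Rightarrow> complex" and \<phi>0 \<omega>0 \<kappa>1 r :: real
    and v0 v1 v2 h1 h2 :: "complex^'n"
    and I J :: "real set" and A :: "real \<Rightarrow> real \<Rightarrow> real \<Rightarrow> complex"
  defines "L0 \<equiv> symbol R (\<lambda>m. M m 0) \<phi>0"
    and "L1 \<equiv> symbol R (\<lambda>m. real_of_int m *\<^sub>R M m 0) \<phi>0"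
    and "L2 \<equiv> symbol R (\<lambda>m. (real_of_int m)\<^sup>2 *\<^sub>R M m 0) \<phi>0"
    and "LK \<equiv> symbol R K \<phi>0"
    and "L3 \<equiv> mat (3 * \<i> * of_real \<omega>0) - symbol R (\<lambda>m. M m 0) (3 * \<phi>0)"
  assumes M_expansion: "\<And>m. \<bar>m\<bar> \<le> int R \<Longrightarrow>
        (\<lambda>p. norm (M m p - M m 0 - p *\<^sub>R K m)) \<in> O[at 0](\<lambda>p. p\<^sup>2)"
    and stencil: "bij_betw off UNIV {- int R..int R}"
    and h_zero: "\<And>p. h 0 p = 0"
    and h_deriv: "\<And>p. ((\<lambda>y. h y p) has_derivative (\<lambda>_. 0)) (at 0)"
    and h_cont: "\<And>p. continuous_on UNIV (\<lambda>y. h y p)"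
    and h_third_order: "third_order h"
    and h_homogeneous: "cubic_coefficients h off v0 0 h1 h2"
    and h_contribution: "cubic_coefficients h off v0 \<phi>0 h1 h2"
    and branch: "regular_point R M lam \<phi>0"
    and critical: "lam \<phi>0 = \<i> * of_real \<omega>0"
    and group_velocity: "(lam has_vector_derivative \<i> * of_real \<kappa>1) (at \<phi>0)"
    and nonresonance: "3 * \<i> * of_real \<omega>0 \<notin> spectrum_at R M 0 \<phi>0"
        "- (3 * \<i> * of_real \<omega>0) \<notin> spectrum_at R M 0 \<phi>0"
    and eigenvector: "(mat (\<i> * of_real \<omega>0) - L0) *v v0 = 0"
    and eigenvector_unique: "\<And>w. (mat (\<i> * of_real \<omega>0) - L0) *v w = 0 \<Longrightarrow> \<exists>c. w = c *s v0"
    and adjoint_eigenvector: "(mat (- \<i> * of_real \<omega>0) - cadjoint L0) *v v1 = 0"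
    and normalization: "(norm v0)\<^sup>2 = 1" "cinner v0 v1 = 1"
    and time_domains: "open I" "connected I" "open J"
    and amplitude: "smooth_amplitude I J A"
    and nontrivial: "\<exists>T1\<in>I. \<exists>x1. \<exists>T2\<in>J. A T1 x1 T2 \<noteq> 0"
    and ring: "\<And>T1 x1 T2. T1 \<in> I \<Longrightarrow> T2 \<in> J \<Longrightarrow> A T1 (x1 + 1) T2 = A T1 x1 T2"
    and solvability: "solvability_conditions R M h off \<omega>0 \<phi>0 v0 v1 v2 r I J A"
  shows "of_real \<kappa>1 = cinner (L1 *v v0) v1
    \<and> (\<exists>u. (\<forall>T1\<in>I. \<forall>x1. \<forall>T2\<in>J. A T1 x1 T2 = u (\<kappa>1 * T1 + x1) T2)
         \<and> (\<forall>\<xi>. \<forall>T2\<in>J. u \<xi> T2 = u (\<xi> + 1) T2)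
         \<and> ginzburg_landau J r
              (cinner (LK *v v0) v1) (cinner (L2 *v v0) v1) (cinner h1 v1) u)
    \<and> L3 *v v2 = h2
    \<and> (invertible L3 \<longrightarrow> v2 = matrix_inv L3 *v h2)"
proof -
  have mat_diff: "(mat c - L) *v w = 0 \<longleftrightarrow> L *v w = c *s w" for c L and w :: "complex^'n"
    by (auto simp: matrix_vector_mult_diff_rdistrib mat_mult_vector)
  have right: "L0 *v v0 = (\<i> * of_real \<omega>0) *s v0"
    using eigenvector by (simp only: mat_diff)
  \<comment> \<open>Conjugate linearity in the second argument turns the adjoint eigenvalue back
    into \<open>\<i> * of_real \<omega>0\<close>.\<close>
  have left: "cinner (L0 *v w) v1 = \<i> * of_real \<omega>0 * cinner w v1" for w
  proof -
    have "cadjoint L0 *v v1 = (- \<i> * of_real \<omega>0) *s v1"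
      using adjoint_eigenvector by (simp only: mat_diff)
    then show ?thesis
      unfolding cinner_adjoint by (simp add: cinner_def sum_distrib_left algebra_simps)
  qed
  have \<kappa>1: "of_real \<kappa>1 = cinner (L1 *v v0) v1"
    unfolding L1_def
  proof (rule group_velocity_eq[OF branch critical group_velocity])
    show "\<exists>c. w = c *s v0" if "symbol R (\<lambda>m. M m 0) \<phi>0 *v w = (\<i> * of_real \<omega>0) *s w" for w
      using eigenvector_unique[of w] that unfolding mat_diff L0_def .
  qed (use right left normalization(2) in \<open>simp_all add: L0_def\<close>)
  define Ax where "Ax T1 T2 x = vector_derivative (\<lambda>x1. A T1 x1 T2) (at x)" for T1 T2 x
  define Axx where "Axx T1 T2 x = vector_derivative (Ax T1 T2) (at x)" for T1 T2 x
  have "open (I \<times> (UNIV :: real set) \<times> J)"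
    using time_domains by (intro open_Times open_UNIV)
  then have A_diff: "(\<lambda>(T1, x1, T2). A T1 x1 T2) differentiable (at (T1, x1, T2))"
    if "T1 \<in> I" "T2 \<in> J" for T1 x1 T2
    using amplitude that unfolding smooth_amplitude_def
    by (auto simp: differentiable_on_eq_differentiable_at)
  have Ax_deriv: "(Ax T1 T2 has_vector_derivative Axx T1 T2 x) (at x)"
    if "T1 \<in> I" "T2 \<in> J" for T1 T2 x
    using amplitude that unfolding smooth_amplitude_def Axx_def Ax_def[abs_def]
    by (auto simp: differentiable_on_def vector_derivative_works[symmetric])
  have slice: "((\<lambda>x. A T1 x T2) has_vector_derivative Ax T1 T2 x) (at x)"
    if "T1 \<in> I" "T2 \<in> J" for T1 T2 x
  proof -
    have "(\<lambda>x. (T1, x, T2)) differentiable (at x)"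
      by (auto simp: differentiable_def intro!: derivative_eq_intros)
    from differentiable_compose[OF _ this, of "\<lambda>(T1, x1, T2). A T1 x1 T2"] A_diff[OF that]
    show ?thesis by (simp add: Ax_def vector_derivative_works[symmetric])
  qed
  \<comment> \<open>All partial derivatives are expressed through one joint derivative
    \<open>D\<close>, so that directional derivatives along characteristics follow by
    linearity.\<close>
  have equations: "\<exists>D. ((\<lambda>(T1, x1, T2). A T1 x1 T2) has_derivative D) (at (T1, x1, T2))
      \<and> D (1, 0, 0) = of_real \<kappa>1 * Ax T1 T2 x1 \<and> D (0, 1, 0) = Ax T1 T2 x1
      \<and> D (0, 0, 1) = of_real r * cinner (LK *v v0) v1 * A T1 x1 T2
          + cinner (L2 *v v0) v1 / 2 * Axx T1 T2 x1
          + cinner h1 v1 * A T1 x1 T2 * of_real (norm (A T1 x1 T2) ^ 2)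
      \<and> (A T1 x1 T2 \<noteq> 0 \<longrightarrow> L3 *v v2 = h2)"
    if point: "T1 \<in> I" "T2 \<in> J" for T1 x1 T2
  proof -
    obtain D where D: "((\<lambda>(T1, x1, T2). A T1 x1 T2) has_derivative D) (at (T1, x1, T2))"
      using A_diff[OF point] unfolding differentiable_def by blast
    interpret amplitude_expansion R M K off h \<phi>0 \<omega>0 r v0 v1 v2 h1 h2 A T1 x1 T2 D
        "Ax T1 T2" "Axx T1 T2 x1"
      by unfold_locales
         (use M_expansion h_zero h_cont h_third_order h_contribution left[of v0] normalization(2)
            D slice[OF point] Ax_deriv[OF point] in \<open>simp_all add: L0_def\<close>)
    have cond: "(\<lambda>N. cinner (harmonic 1 (res (1 / real N))) v1) \<in> o(\<lambda>N. complex_of_real ((1 / real N)\<^sup>2))"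
      "(\<lambda>N. norm (harmonic 3 (res (1 / real N)))) \<in> o(\<lambda>N. (1 / real N)\<^sup>2)"
      using solvability point unfolding solvability_conditions_def by blast+
    have "((\<lambda>x. (T1, x, T2)) has_derivative (\<lambda>x. (0, x, 0))) (at x1)"
      by (auto intro!: derivative_eq_intros)
    from has_derivative_compose[OF this, of "\<lambda>(T1, x1, T2). A T1 x1 T2" D] D
    have "((\<lambda>x. A T1 x T2) has_derivative (\<lambda>x. D (0, x, 0))) (at x1)" by simp
    then have "(\<lambda>x. D (0, x, 0)) = (\<lambda>x. x *\<^sub>R Ax T1 T2 x1)"
      using slice[OF point, of x1] unfolding has_vector_derivative_def by (rule has_derivative_unique)
    then have "D (0, 1, 0) = Ax T1 T2 x1" by (metis scaleR_one)
    then show ?thesis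
      using D amplitude_equations[OF cond(1)] third_harmonic_equation[OF cond(2)] \<kappa>1
      unfolding L1_def L2_def LK_def L3_def by auto
  qed
  obtain S where S: "S \<in> I" using nontrivial by blast
  \<comment> \<open>A reference time \<open>S\<close> replaces the unspecified initial time: the
    characteristic with label \<open>\<xi>\<close> meets \<open>T1 = S\<close> at
    \<open>x1 = \<xi> - \<kappa>1 * S\<close>. The derivatives of \<open>u\<close> are then those of
    \<open>A\<close> on the slice \<open>T1 = S\<close>.\<close>
  define u where "u \<xi> T2 = A S (\<xi> - \<kappa>1 * S) T2" for \<xi> T2
  have "A T1 x1 T2 = u (\<kappa>1 * T1 + x1) T2" if "T1 \<in> I" "T2 \<in> J" for T1 x1 T2
  proof -
    define \<xi> where "\<xi> = \<kappa>1 * T1 + x1"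
    have "((\<lambda>s. A s (\<xi> - \<kappa>1 * s) T2) has_derivative (\<lambda>_. 0)) (at s within I)" if s: "s \<in> I" for s
    proof -
      obtain D where D: "((\<lambda>(T1, x1, T2). A T1 x1 T2) has_derivative D) (at (s, \<xi> - \<kappa>1 * s, T2))"
          "D (1, 0, 0) = of_real \<kappa>1 * D (0, 1, 0)"
        using equations[OF s \<open>T2 \<in> J\<close>, of "\<xi> - \<kappa>1 * s"] by metis
      have "linear D" using D(1) has_derivative_linear by blast
      \<comment> \<open>The direction (1, -\<open>\<kappa>1\<close>, 0) keeps
        \<open>\<kappa>1 * T1 + x1\<close> fixed, and the order \<open>\<epsilon>\<close> equation
        says exactly that \<open>D\<close> annihilates it.\<close>
      have "D (t, - (\<kappa>1 * t), 0) = 0" for t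
      proof -
        have "D (t, - (\<kappa>1 * t), 0) = D (t *\<^sub>R (1, 0, 0) + (- (\<kappa>1 * t)) *\<^sub>R (0, 1, 0))" by simp
        also have "\<dots> = t *\<^sub>R D (1, 0, 0) + (- (\<kappa>1 * t)) *\<^sub>R D (0, 1, 0)"
          by (simp only: linear_add[OF \<open>linear D\<close>] linear_cmul[OF \<open>linear D\<close>])
        finally show ?thesis by (simp add: D(2) scaleR_conv_of_real)
      qed
      moreover have "((\<lambda>s. (s, \<xi> - \<kappa>1 * s, T2)) has_derivative (\<lambda>t. (t, - (\<kappa>1 * t), 0))) (at s)"
        by (auto intro!: derivative_eq_intros)
      from has_derivative_compose[OF this, of "\<lambda>(T1, x1, T2). A T1 x1 T2" D] D(1)
      have "((\<lambda>s. A s (\<xi> - \<kappa>1 * s) T2) has_derivative (\<lambda>t. D (t, - (\<kappa>1 * t), 0))) (at s)" by simp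
      ultimately show ?thesis by (simp add: has_derivative_at_withinI)
    qed
    \<comment> \<open>On the line connected sets are convex, which lets a vanishing derivative on
      \<open>I\<close> force constancy between \<open>T1\<close> and \<open>S\<close>.\<close>
    moreover have "convex I"
      using time_domains(2) by (simp add: connected_convex_1)
    ultimately have "A T1 (\<xi> - \<kappa>1 * T1) T2 = A S (\<xi> - \<kappa>1 * S) T2"
      using S \<open>T1 \<in> I\<close>
      by (intro has_derivative_zero_unique[of I "\<lambda>s. A s (\<xi> - \<kappa>1 * s) T2" T1 S])
    then show ?thesis by (simp add: u_def \<xi>_def)
  qed
  moreover have "u \<xi> T2 = u (\<xi> + 1) T2" if "T2 \<in> J" for \<xi> T2
    using ring[OF S that, of "\<xi> - \<kappa>1 * S"] by (simp add: u_def algebra_simps)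
  moreover have "ginzburg_landau J r (cinner (LK *v v0) v1) (cinner (L2 *v v0) v1) (cinner h1 v1) u"
    unfolding ginzburg_landau_def
  proof (rule exI[of _ "\<lambda>\<xi> T2. Ax S T2 (\<xi> - \<kappa>1 * S)"],
      rule exI[of _ "\<lambda>\<xi> T2. Axx S T2 (\<xi> - \<kappa>1 * S)"], intro allI ballI conjI)
    fix \<xi> T2 assume T2: "T2 \<in> J"
    have shift: "((\<lambda>x. f (x - c)) has_vector_derivative d) (at \<xi>)"
      if "(f has_vector_derivative d) (at (\<xi> - c))" for f :: "real \<Rightarrow> complex" and c d
    proof -
      have "((\<lambda>x. x - c) has_vector_derivative 1) (at \<xi>)"
        by (auto intro!: derivative_eq_intros simp: has_vector_derivative_def)
      from vector_diff_chain_at[OF this that] show ?thesis by (simp add: o_def)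
    qed
    show "((\<lambda>x. u x T2) has_vector_derivative Ax S T2 (\<xi> - \<kappa>1 * S)) (at \<xi>)"
      unfolding u_def using shift[of "\<lambda>x. A S x T2", OF slice[OF S T2]] .
    show "((\<lambda>x. Ax S T2 (x - \<kappa>1 * S)) has_vector_derivative Axx S T2 (\<xi> - \<kappa>1 * S)) (at \<xi>)"
      using shift[of "Ax S T2", OF Ax_deriv[OF S T2]] .
    obtain D where D: "((\<lambda>(T1, x1, T2). A T1 x1 T2) has_derivative D) (at (S, \<xi> - \<kappa>1 * S, T2))"
        "D (0, 0, 1) = of_real r * cinner (LK *v v0) v1 * u \<xi> T2
          + cinner (L2 *v v0) v1 / 2 * Axx S T2 (\<xi> - \<kappa>1 * S)
          + cinner h1 v1 * u \<xi> T2 * of_real (norm (u \<xi> T2) ^ 2)"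
      using equations[OF S T2, of "\<xi> - \<kappa>1 * S"] unfolding u_def by (elim exE conjE)
    have "((\<lambda>\<tau>. (S, \<xi> - \<kappa>1 * S, \<tau>)) has_derivative (\<lambda>t. (0, 0, t))) (at T2)"
      by (auto intro!: derivative_eq_intros)
    from has_derivative_compose[OF this, of "\<lambda>(T1, x1, T2). A T1 x1 T2" D] D(1)
    have u_deriv: "((\<lambda>\<tau>. u \<xi> \<tau>) has_derivative (\<lambda>t. D (0, 0, t))) (at T2)" by (simp add: u_def)
    have D_eq: "(\<lambda>t. D (0, 0, t)) = (\<lambda>t. t *\<^sub>R D (0, 0, 1))"
    proof
      show "D (0, 0, t) = t *\<^sub>R D (0, 0, 1)" for t
        using linear_cmul[OF has_derivative_linear[OF D(1)], of t "(0, 0, 1)"] by simp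
    qed
    show "((\<lambda>\<tau>. u \<xi> \<tau>) has_vector_derivative
        (of_real r * cinner (LK *v v0) v1 * u \<xi> T2
          + cinner (L2 *v v0) v1 / 2 * Axx S T2 (\<xi> - \<kappa>1 * S)
          + cinner h1 v1 * u \<xi> T2 * of_real (norm (u \<xi> T2) ^ 2))) (at T2)"
      using u_deriv unfolding has_vector_derivative_def D_eq D(2)[symmetric] .
  qed
  \<comment> \<open>\<open>L3\<close>, \<open>v2\<close> and \<open>h2\<close> do not depend on the
    slow point, so a single point where \<open>A\<close> is nonzero suffices. The equation holds
    whether or not \<open>L3\<close> is singular; invertibility only serves to solve it for
    \<open>v2\<close>.\<close>
  moreover have v2: "L3 *v v2 = h2"
    using nontrivial equations by blast
  moreover have "v2 = matrix_inv L3 *v h2" if "invertible L3"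
  proof -
    have "L3 ** matrix_inv L3 = mat 1 \<and> matrix_inv L3 ** L3 = mat 1"
      using that unfolding invertible_def matrix_inv_def by (rule someI_ex)
    then show ?thesis by (simp add: v2[symmetric] matrix_vector_mul_assoc)
  qed
  ultimately show ?thesis using \<kappa>1 by blast
qed

end
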